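(* Let $\alpha\in[0,1)$, let $F(x)=e^{x^{\frac{2\alpha}{1-\alpha}}}$ and $\sigma(n)=e^{-n^{\alpha}}$. Then there exists an infinite graph $D_F=(V(D_F),E(D_F))$ with bounded valency such that: (i) $\mathrm{Fol}_{D_F}\approx F$; (ii) there exists a point $d_0\in V(D_F)$ such that $p^{D_F}_n(d_0,d_0)\approx\sigma(n)$, where $p_n^{D_F}(x,y)=\mathbb{P}(X_n=y\mid X_0=x)$ denotes the $n$-step transition probability of the lazy random walk $X$ on $D_F$ defined in the context.
   Context: Graphs are undirected, unweighted, infinite and of bounded geometry (the number of neighbours is uniformly bounded); $\nu(a)$ is the number of neighbours of the vertex $a$. The random walk $X$ on a graph $G$ has transition probabilities $\mathbb{P}(X_{n+1}=b\mid X_n=a)=\frac{1}{\nu(a)+1}\bigl(1_{\{(a,b)\in E(G)\}}+1_{\{a=b\}}\bigr)$, i.e. it jumps uniformly on the set formed by the current point and its neighbours. For $A\subset V(G)$, $\partial_G A=\{(x,y)\in E(G): x\in A,\ y\in V(G)\setminus A\}$. The Følner function of $G$ is $\mathrm{Fol}_G(k)=\min\{|U| : U\subset V(G)\text{ finite nonempty},\ |\partial_G U|/|U|\le 1/k\}$. Notation: $a_n\preceq b_n$ means that there exist constants $c_1,c_2>0$ such that $a_n\le c_1 b_{c_2n}$ for all $n\ge 0$ (when a sequence is only defined at integers, $c_2$ is taken so that $c_2n$ is an integer); $a_n\succeq b_n$ means $b_n\preceq a_n$; $a_n\approx b_n$ means $a_n\preceq b_n$ and $a_n\succeq b_n$.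 *)

theory Defs
  imports "HOL-Probability.Probability" "Graph_Theory.Pair_Digraph"
begin

definition neighbours :: "'a pair_pre_digraph \<Rightarrow> 'a \<Rightarrow> 'a set" where
  "neighbours G a = {b. (a, b) \<in> parcs G}"

definition valency :: "'a pair_pre_digraph \<Rightarrow> 'a \<Rightarrow> nat" where
  "valency G a = card (neighbours G a)"

text \<open>An undirected simple graph is encoded as a loopfree digraph without parallel arcs whose
  arc relation is symmetric.  Neither finiteness nor connectedness is part of
  \<open>pair_bidirected_digraph\<close>.\<close>

definition bounded_geometry :: "'a pair_pre_digraph \<Rightarrow> bool" where
  "bounded_geometry G \<longleftrightarrow> pair_bidirected_digraph G \<and>
     (\<exists>C. \<forall>a\<in>pverts G. finite (neighbours G a) \<and> valency G a \<le> C)"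

definition edge_boundary :: "'a pair_pre_digraph \<Rightarrow> 'a set \<Rightarrow> ('a \<times> 'a) set" where
  "edge_boundary G A = {(x, y) \<in> parcs G. x \<in> A \<and> y \<in> pverts G - A}"

text \<open>The minimum is taken as an infimum in the extended nonnegative reals, so that it is
  \<open>\<infinity>\<close> when no admissible set exists; otherwise it is attained, because cardinalities are natural
  numbers.  The quotients are extended ones too: \<open>1 / 0 = \<infinity>\<close>, so every set is admissible
  for \<open>k = 0\<close>.\<close>

definition Folner :: "'a pair_pre_digraph \<Rightarrow> nat \<Rightarrow> ennreal" where
  "Folner G k = (INF U \<in> {U. U \<subseteq> pverts G \<and> finite U \<and> U \<noteq> {} \<and>
       (of_nat (card (edge_boundary G U)) / of_nat (card U) :: ennreal) \<le> 1 / of_nat k}.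
     of_nat (card U))"

definition walk_step :: "'a pair_pre_digraph \<Rightarrow> 'a \<Rightarrow> 'a pmf" where
  "walk_step G a = pmf_of_set (insert a (neighbours G a))"

lemma pmf_walk_step:
  assumes "bounded_geometry G" "a \<in> pverts G"
  shows "pmf (walk_step G a) b =
    1 / (real (valency G a) + 1) * (of_bool ((a, b) \<in> parcs G) + of_bool (a = b))"
proof -
  interpret pair_bidirected_digraph G
    using assms(1) by (simp add: bounded_geometry_def)
  have fin: "finite (neighbours G a)"
    using assms by (auto simp: bounded_geometry_def)
  have "a \<notin> neighbours G a"
    using pair_no_loops by (force simp: neighbours_def)
  then show ?thesis
    using fin by (auto simp: walk_step_def valency_def neighbours_def indicator_def)
qed

text \<open>The law of \<open>X\<^sub>n\<close> given \<open>X\<^sub>0 = x\<close>.\<close>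

primrec walk :: "'a pair_pre_digraph \<Rightarrow> nat \<Rightarrow> 'a \<Rightarrow> 'a pmf" where
  "walk G 0 x = return_pmf x"
| "walk G (Suc n) x = bind_pmf (walk G n x) (walk_step G)"

definition transition_prob :: "'a pair_pre_digraph \<Rightarrow> nat \<Rightarrow> 'a \<Rightarrow> 'a \<Rightarrow> real" where
  "transition_prob G n x y = pmf (walk G n x) y"

text \<open>The comparison of a sequence \<open>a\<close> defined at the integers with a function \<open>b\<close> defined on the
  nonnegative reals.  The inner constant \<open>c\<^sub>2\<close> rescales the argument of the right-hand
  side, so it is a positive real when \<open>b\<close> is on the right, and a positive integer
  when \<open>a\<close> is on the right.\<close>

definition preceq_fun :: "(nat \<Rightarrow> ennreal) \<Rightarrow> (real \<Rightarrow> ennreal) \<Rightarrow> bool" where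
  "preceq_fun a b \<longleftrightarrow>
     (\<exists>(c\<^sub>1::real) > 0. \<exists>(c\<^sub>2::real) > 0. \<forall>n::nat. a n \<le> ennreal c\<^sub>1 * b (c\<^sub>2 * real n))"

definition succeq_fun :: "(nat \<Rightarrow> ennreal) \<Rightarrow> (real \<Rightarrow> ennreal) \<Rightarrow> bool" where
  "succeq_fun a b \<longleftrightarrow>
     (\<exists>(c\<^sub>1::real) > 0. \<exists>(c\<^sub>2::nat) > 0. \<forall>n::nat. b (real n) \<le> ennreal c\<^sub>1 * a (c\<^sub>2 * n))"

definition approx_fun :: "(nat \<Rightarrow> ennreal) \<Rightarrow> (real \<Rightarrow> ennreal) \<Rightarrow> bool" where
  "approx_fun a b \<longleftrightarrow> preceq_fun a b \<and> succeq_fun a b"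

text \<open>Real powers with the usual convention \<open>x\<^sup>0 = 1\<close> also at \<open>x = 0\<close>, where \<open>powr\<close> gives \<open>0\<close>.\<close>

definition rpow :: "real \<Rightarrow> real \<Rightarrow> real" where
  "rpow x s = (if s = 0 then 1 else x powr s)"

end

theory Submission
  imports Defs
begin

text \<open>
  For \<open>\<alpha> > 0\<close> put \<open>b = (1 - \<alpha>) / (2\<alpha>)\<close>. Start from the rooted binary tree, hang at every vertex of level
  \<open>j\<close> a path of length \<open>K\<^sub>j\<close> of order \<open>j\<^sup>b\<close>, and put on each of the \<open>K\<^sub>j + 1\<close> copies of the level (a set of
  \<open>2\<^sup>j\<close> vertices) the arcs of 8 permutations that double every set of size at most \<open>2\<^sup>j\<^sup>/\<^sup>2 / 2\<close>; such
  permutations exist by counting.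

  A set of size at most \<open>2\<^sup>J\<^sup>/\<^sup>2 / 2\<close> loses a fixed proportion of its part in the levels from \<open>J\<close> on through the
  permutation arcs, and a proportion \<open>1 / (K\<^sub>J + 1)\<close> of its part below level \<open>J\<close> through the fibres and the
  tree, which is non-amenable. The fibres over one level are nearly optimal, their only boundary being tree
  arcs. This gives the Folner function. The Cheeger and Faber-Krahn inequalities turn the isoperimetry
  into the upper bound on the return probability. For the lower bound at time \<open>n\<close>, the walk goes from the
  root to a level \<open>j\<close> of order \<open>n\<^sup>\<alpha>\<close> and stays in the fibres over it, where the sine wave along the fibres has
  eigenvalue \<open>1 - O(K\<^sub>j\<^sup>-\<^sup>2)\<close>; the cost of each stage is \<open>exp (- O(n\<^sup>\<alpha>))\<close>. Since the inner constant in
  \<open>\<sigma>(n) \<le> c\<^sub>1 p(c\<^sub>2 n)\<close> is a positive integer, the constant in this exponent has to be at most 1, which is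
  achieved by a small \<open>j / n\<^sup>\<alpha>\<close> and a large \<open>K\<^sub>j / j\<^sup>b\<close>.
\<close>

section \<open>Relabelling\<close>

text \<open>The construction lives on pairs of a bit string and a height, whereas the theorem asks
  for vertices of type \<open>nat\<close>; everything is transported along an injection.\<close>

definition relabel :: "('a \<Rightarrow> 'b) \<Rightarrow> 'a pair_pre_digraph \<Rightarrow> 'b pair_pre_digraph" where
  "relabel e G = \<lparr>pverts = e ` pverts G, parcs = map_prod e e ` parcs G\<rparr>"

lemma relabel_simps:
  "pverts (relabel e G) = e ` pverts G" "parcs (relabel e G) = map_prod e e ` parcs G"
  by (simp_all add: relabel_def)

context
  fixes e :: "'a \<Rightarrow> 'b" and G :: "'a pair_pre_digraph"
  assumes e: "inj e"
begin

lemma neighbours_relabel: "neighbours (relabel e G) (e a) = e ` neighbours G a"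
  by (auto simp: neighbours_def relabel_simps inj_eq[OF e])

lemma bounded_geometry_relabel:
  assumes "bounded_geometry G"
  shows "bounded_geometry (relabel e G)"
proof -
  interpret pair_bidirected_digraph G using assms by (simp add: bounded_geometry_def)
  have "pair_bidirected_digraph (relabel e G)"
  proof
    have "(b, a) \<in> parcs G" if "(a, b) \<in> parcs G" for a b
      using pair_sym_arcs that by (auto simp: symmetric_def sym_def)
    then show "symmetric (with_proj (relabel e G))"
      by (auto simp: symmetric_def sym_def relabel_simps inj_eq[OF e])
  next
    fix a assume "a \<in> parcs (relabel e G)"
    then obtain x y where a: "a = (e x, e y)" "(x, y) \<in> parcs G" by (auto simp: relabel_simps)
    show "fst a \<in> pverts (relabel e G)" "snd a \<in> pverts (relabel e G)" "fst a \<noteq> snd a"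
      using arc_fst_in_verts[OF a(2)] arc_snd_in_verts[OF a(2)] pair_no_loops[OF a(2)]
      by (auto simp: a relabel_simps inj_eq[OF e])
  qed
  moreover obtain C where C: "\<And>a. a \<in> pverts G \<Longrightarrow> finite (neighbours G a) \<and> valency G a \<le> C"
    using assms by (auto simp: bounded_geometry_def)
  have "finite (neighbours (relabel e G) a) \<and> valency (relabel e G) a \<le> C"
    if a: "a \<in> pverts (relabel e G)" for a
  proof -
    obtain x where x: "a = e x" "x \<in> pverts G" using a by (auto simp: relabel_simps)
    then show ?thesis
      using C[of x] card_image[OF inj_on_subset[OF e subset_UNIV], of "neighbours G x"]
      by (auto simp: neighbours_relabel valency_def)
  qed
  ultimately show ?thesis by (auto simp: bounded_geometry_def)
qed

lemma Folner_relabel: "Folner (relabel e G) k = Folner G k"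
proof -
  have bd: "edge_boundary (relabel e G) (e ` U) = map_prod e e ` edge_boundary G U" for U
    by (auto simp: edge_boundary_def relabel_simps inj_eq[OF e])
  have inj2: "inj (map_prod e e)" using e by (simp add: prod.inj_map)
  have c: "card (e ` U) = card U" "card (edge_boundary (relabel e G) (e ` U)) = card (edge_boundary G U)" for U
    unfolding bd by (rule card_image[OF inj_on_subset[OF e subset_UNIV]])
      (rule card_image[OF inj_on_subset[OF inj2 subset_UNIV]])
  \<comment> \<open>Hiding the ratio behind \<open>P\<close> makes admissibility a condition on two
    cardinalities, both preserved by the injection.\<close>
  define P where "P n m \<longleftrightarrow> (of_nat n / of_nat m :: ennreal) \<le> 1 / of_nat k" for n m :: nat
  have "{U. U \<subseteq> pverts (relabel e G) \<and> finite U \<and> U \<noteq> {} \<and> P (card (edge_boundary (relabel e G) U)) (card U)}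
    = (`) e ` {U. U \<subseteq> pverts G \<and> finite U \<and> U \<noteq> {} \<and> P (card (edge_boundary G U)) (card U)}"
  proof (intro equalityI subsetI)
    fix W assume W: "W \<in> {U. U \<subseteq> pverts (relabel e G) \<and> finite U \<and> U \<noteq> {} \<and> P (card (edge_boundary (relabel e G) U)) (card U)}"
    then obtain U where U: "W = e ` U" "U \<subseteq> pverts G" by (auto simp: relabel_simps subset_image_iff)
    then have "finite U" using W finite_image_iff[OF inj_on_subset[OF e subset_UNIV]] by auto
    then show "W \<in> (`) e ` {U. U \<subseteq> pverts G \<and> finite U \<and> U \<noteq> {} \<and> P (card (edge_boundary G U)) (card U)}"
      using W U c by auto
  next
    fix W assume "W \<in> (`) e ` {U. U \<subseteq> pverts G \<and> finite U \<and> U \<noteq> {} \<and> P (card (edge_boundary G U)) (card U)}"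
    then show "W \<in> {U. U \<subseteq> pverts (relabel e G) \<and> finite U \<and> U \<noteq> {} \<and> P (card (edge_boundary (relabel e G) U)) (card U)}"
      using c by (auto simp: relabel_simps)
  qed
  then show ?thesis
    unfolding Folner_def P_def by (simp add: image_image c)
qed

text \<open>An injection maps the uniform law on a finite set to the uniform law on its image, so it
  commutes with each step of the walk.\<close>

lemma walk_relabel:
  assumes "\<And>a. finite (neighbours G a)"
  shows "walk (relabel e G) n (e x) = map_pmf e (walk G n x)"
proof (induction n)
  case (Suc n)
  have "walk_step (relabel e G) (e y) = map_pmf e (walk_step G y)" for y
    unfolding walk_step_def neighbours_relabel image_insert[symmetric]
    using assms by (intro map_pmf_of_set_inj[symmetric] inj_on_subset[OF e]) auto
  then show ?case by (simp add: Suc bind_map_pmf map_bind_pmf)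
qed simp

lemma transition_prob_relabel:
  assumes "\<And>a. finite (neighbours G a)"
  shows "transition_prob (relabel e G) n (e x) (e y) = transition_prob G n x y"
  unfolding transition_prob_def walk_relabel[OF assms] by (rule pmf_map_inj'[OF e])

end

section \<open>Random walks on graphs of bounded degree\<close>

locale bounded_graph =
  fixes G :: "'a pair_pre_digraph" and D :: nat
  assumes bidirected: "pair_bidirected_digraph G"
    and finite_nbr: "a \<in> pverts G \<Longrightarrow> finite (neighbours G a)"
    and valency_le: "a \<in> pverts G \<Longrightarrow> valency G a \<le> D"
begin

text \<open>\<open>hood a\<close> is the support of one step from \<open>a\<close>; its cardinality
  \<open>mass a\<close> is also the reversible measure of the walk, and \<open>avg\<close> is the
  Markov operator.\<close>

definition hood :: "'a \<Rightarrow> 'a set" where "hood a = insert a (neighbours G a)"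

definition mass :: "'a \<Rightarrow> real" where "mass a = real (valency G a) + 1"

definition avg :: "('a \<Rightarrow> real) \<Rightarrow> 'a \<Rightarrow> real" where "avg f z = (\<Sum>y\<in>hood z. f y) / mass z"

lemma arc_verts: "(x, y) \<in> parcs G \<Longrightarrow> x \<in> pverts G \<and> y \<in> pverts G"
proof -
  interpret pair_bidirected_digraph G by (rule bidirected)
  assume "(x, y) \<in> parcs G"
  then show ?thesis using arc_fst_in_verts arc_snd_in_verts by fastforce
qed

lemma arc_sym: "(x, y) \<in> parcs G \<Longrightarrow> (y, x) \<in> parcs G"
proof -
  interpret pair_bidirected_digraph G by (rule bidirected)
  assume "(x, y) \<in> parcs G"
  then show ?thesis using pair_sym_arcs by (auto simp: symmetric_def sym_def)
qed

lemma arc_irrefl: "(x, x) \<notin> parcs G"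
proof -
  interpret pair_bidirected_digraph G by (rule bidirected)
  show ?thesis using pair_no_loops by force
qed

text \<open>Arcs join vertices only, which extends the finiteness and valency bounds to all elements
  of the type.\<close>

lemma nbr_outside: "a \<notin> pverts G \<Longrightarrow> neighbours G a = {}"
  using arc_verts by (auto simp: neighbours_def)

lemma finite_neighbours: "finite (neighbours G a)"
  using finite_nbr nbr_outside by (cases "a \<in> pverts G") auto

lemma valency_bound: "valency G a \<le> D"
  using valency_le nbr_outside by (cases "a \<in> pverts G") (auto simp: valency_def)

lemma finite_hood: "finite (hood a)"
  by (simp add: hood_def finite_neighbours)

lemma self_in_hood: "a \<in> hood a"
  by (simp add: hood_def)

lemma hood_sym: "b \<in> hood a \<longleftrightarrow> a \<in> hood b"
  using arc_sym by (auto simp: hood_def neighbours_def)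

lemma hood_verts: "a \<in> pverts G \<Longrightarrow> b \<in> hood a \<Longrightarrow> b \<in> pverts G"
  using arc_verts by (auto simp: hood_def neighbours_def)

lemma card_hood: "real (card (hood a)) = mass a"
  using arc_irrefl finite_neighbours
  by (simp add: hood_def mass_def valency_def neighbours_def)

lemma mass_ge_1: "1 \<le> mass a" and mass_pos: "0 < mass a" and mass_le: "mass a \<le> real D + 1"
  using valency_bound[of a] by (auto simp: mass_def)

lemma pmf_step: "pmf (walk_step G a) b = of_bool (b \<in> hood a) / mass a"
proof -
  have "hood a \<noteq> {}" using self_in_hood by auto
  then show ?thesis
    using finite_hood[of a] card_hood[of a]
    by (auto simp: walk_step_def hood_def[symmetric] pmf_of_set indicator_def)
qed

lemma set_walk_step: "set_pmf (walk_step G a) = hood a"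
proof -
  have "hood a \<noteq> {}" using self_in_hood by auto
  then show ?thesis
    using finite_hood[of a] by (simp add: walk_step_def hood_def[symmetric] set_pmf_of_set)
qed

lemma finite_set_walk: "finite (set_pmf (walk G n x))"
  by (induction n) (auto simp: set_walk_step finite_hood)

lemma set_walk_verts: "x \<in> pverts G \<Longrightarrow> set_pmf (walk G n x) \<subseteq> pverts G"
  by (induction n) (auto simp: set_walk_step dest: hood_verts)

lemma pmf_bind_finite:
  assumes "finite A" "set_pmf M \<subseteq> A"
  shows "pmf (bind_pmf M f) z = (\<Sum>y\<in>A. pmf M y * pmf (f y) z)"
  unfolding pmf_bind using assms
  by (subst integral_measure_pmf[of A]) (auto simp: set_pmf_iff)

text \<open>Conditioning on the last step: \<open>hood\<close> is symmetric, so the predecessors of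
  \<open>z\<close> are the points of \<open>hood z\<close>. After division by \<open>mass z\<close>
  this says that the density of the walk with respect to \<open>mass\<close> evolves by
  \<open>avg\<close>.\<close>

lemma walk_Suc_sum: "pmf (walk G (Suc n) x) z = (\<Sum>y\<in>hood z. pmf (walk G n x) y / mass y)"
proof -
  let ?A = "set_pmf (walk G n x) \<union> hood z"
  have "pmf (walk G (Suc n) x) z = (\<Sum>y\<in>?A. pmf (walk G n x) y * pmf (walk_step G y) z)"
    using pmf_bind_finite[of ?A "walk G n x"] finite_set_walk finite_hood by simp
  also have "\<dots> = (\<Sum>y\<in>?A. if y \<in> hood z then pmf (walk G n x) y / mass y else 0)"
    by (intro sum.cong) (auto simp: pmf_step hood_sym[of z])
  also have "\<dots> = (\<Sum>y\<in>hood z. pmf (walk G n x) y / mass y)"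
    using finite_set_walk finite_hood
    by (subst sum.inter_filter[symmetric]) (auto intro!: sum.cong)
  finally show ?thesis .
qed

lemma walk_add: "walk G (n + k) x = bind_pmf (walk G n x) (walk G k)"
  by (induction k) (simp_all add: bind_return_pmf' bind_assoc_pmf)

lemma walk_1: "walk G (Suc 0) x = walk_step G x"
  by (simp add: bind_return_pmf)

lemma walk_Suc_first: "pmf (walk G (Suc n) x) z = avg (\<lambda>y. pmf (walk G n y) z) x"
proof -
  have "walk G (Suc n) x = bind_pmf (walk_step G x) (walk G n)"
    using walk_add[of "Suc 0" n x] walk_1[of x] by simp
  then have "pmf (walk G (Suc n) x) z = (\<Sum>y\<in>hood x. pmf (walk_step G x) y * pmf (walk G n y) z)"
    using pmf_bind_finite[of "hood x" "walk_step G x"] finite_hood set_walk_step by simp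
  then show ?thesis
    by (simp add: avg_def pmf_step sum_divide_distrib)
qed

text \<open>The induction expands the left side by its last step and the right side by its first
  step; both sums run over \<open>hood y\<close>.\<close>

lemma walk_reversible: "mass x * pmf (walk G n x) y = mass y * pmf (walk G n y) x"
proof (induction n arbitrary: x y)
  case 0
  show ?case by (auto simp: indicator_def)
next
  case (Suc n)
  have "mass x * pmf (walk G (Suc n) x) y = (\<Sum>z\<in>hood y. mass x * pmf (walk G n x) z / mass z)"
    by (simp add: walk_Suc_sum sum_distrib_left del: walk.simps)
  also have "\<dots> = (\<Sum>z\<in>hood y. pmf (walk G n z) x)"
    using Suc.IH mass_pos by (intro sum.cong) (auto simp: less_imp_neq[symmetric])
  also have "\<dots> = mass y * pmf (walk G (Suc n) y) x"
    unfolding walk_Suc_first avg_def using mass_pos[of y] by simp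
  finally show ?case .
qed

lemma walk_chapman_kolmogorov:
  assumes "finite A" "set_pmf (walk G n x) \<subseteq> A"
  shows "pmf (walk G (n + k) x) z = (\<Sum>y\<in>A. pmf (walk G n x) y * pmf (walk G k y) z)"
  unfolding walk_add by (rule pmf_bind_finite[OF assms])

lemma walk_chapman_ge: "pmf (walk G n x) y * pmf (walk G k y) z \<le> pmf (walk G (n + k) x) z"
proof -
  let ?A = "insert y (set_pmf (walk G n x))"
  have "pmf (walk G n x) y * pmf (walk G k y) z \<le> (\<Sum>y\<in>?A. pmf (walk G n x) y * pmf (walk G k y) z)"
    using finite_set_walk by (intro member_le_sum) auto
  then show ?thesis
    using walk_chapman_kolmogorov[of ?A n x k z] finite_set_walk by (simp add: subset_insertI)
qed

text \<open>Chapman-Kolmogorov at half time, then reversibility. Even return probabilities thus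
  become squared l2 norms, which both the upper and the lower bound exploit.\<close>

lemma walk_double:
  assumes "finite A" "set_pmf (walk G n x) \<subseteq> A"
  shows "pmf (walk G (2 * n) x) x = mass x * (\<Sum>y\<in>A. (pmf (walk G n x) y)\<^sup>2 / mass y)"
proof -
  have eq: "pmf (walk G n y) x = mass x * pmf (walk G n x) y / mass y" for y
    using walk_reversible[of x n y] mass_pos[of y] by (simp add: field_simps)
  have "pmf (walk G (2 * n) x) x = (\<Sum>y\<in>A. pmf (walk G n x) y * pmf (walk G n y) x)"
    using walk_chapman_kolmogorov[OF assms, of n x] by (simp add: mult_2)
  also have "\<dots> = (\<Sum>y\<in>A. mass x * ((pmf (walk G n x) y)\<^sup>2 / mass y))"
    by (intro sum.cong) (auto simp: eq power2_eq_square)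
  finally show ?thesis by (simp add: sum_distrib_left)
qed

lemma step_ge: "b \<in> hood a \<Longrightarrow> 1 / (real D + 1) \<le> pmf (walk_step G a) b"
  using mass_le[of a] mass_pos[of a] by (simp add: pmf_step frac_le)

lemma walk_path_ge:
  assumes "\<And>i. i < n \<Longrightarrow> \<gamma> (Suc i) \<in> hood (\<gamma> i)"
  shows "(1 / (real D + 1)) ^ n \<le> pmf (walk G n (\<gamma> 0)) (\<gamma> n)"
  using assms
proof (induction n)
  case 0
  show ?case by simp
next
  case (Suc n)
  have "(1 / (real D + 1)) ^ Suc n \<le> pmf (walk G n (\<gamma> 0)) (\<gamma> n) * pmf (walk_step G (\<gamma> n)) (\<gamma> (Suc n))"
    using Suc.IH Suc.prems step_ge[of "\<gamma> (Suc n)" "\<gamma> n"]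
    by (subst power_Suc2, intro mult_mono) auto
  also have "\<dots> \<le> pmf (walk G (Suc n) (\<gamma> 0)) (\<gamma> (Suc n))"
    using walk_chapman_ge[of n "\<gamma> 0" "\<gamma> n" "Suc 0"] walk_1 by (simp del: walk.simps)
  finally show ?case .
qed

lemma walk_return_ge: "(1 / (real D + 1)) ^ n \<le> pmf (walk G n x) x"
  using walk_path_ge[of n "\<lambda>_. x"] self_in_hood by simp

section \<open>From isoperimetry to return probabilities\<close>

text \<open>The second moment over \<open>hood z\<close> exceeds \<open>mass z\<close> times the
  squared mean by the variance \<open>V\<close>. Laziness puts \<open>z\<close> itself into
  \<open>hood z\<close>, so \<open>(f z - c)\<^sup>2\<close> is a term of \<open>V\<close>, and
  comparing through \<open>c\<close> bounds the differences along arcs.\<close>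

lemma variance_bound:
  "mass z * (avg f z)\<^sup>2 \<le> (\<Sum>y\<in>hood z. (f y)\<^sup>2)
    - (\<Sum>y\<in>neighbours G z. (f z - f y)\<^sup>2) / (2 * (real D + 2))"
proof -
  define c where "c = avg f z"
  define V where "V = (\<Sum>y\<in>hood z. (f y - c)\<^sup>2)"
  have sum_f: "(\<Sum>y\<in>hood z. f y) = mass z * c"
    using mass_pos[of z] by (simp add: c_def avg_def)
  have "V = (\<Sum>y\<in>hood z. (f y)\<^sup>2) - 2 * c * (\<Sum>y\<in>hood z. f y) + mass z * c\<^sup>2"
    unfolding V_def
    by (simp add: power2_diff sum.distrib sum_subtractf sum_distrib_left card_hood mult_ac)
  then have V_eq: "V = (\<Sum>y\<in>hood z. (f y)\<^sup>2) - mass z * c\<^sup>2"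
    by (simp add: sum_f power2_eq_square)
  have V0: "0 \<le> V" by (simp add: V_def sum_nonneg)
  have zV: "(f z - c)\<^sup>2 \<le> V"
    unfolding V_def using finite_hood self_in_hood by (intro member_le_sum) auto
  have "(\<Sum>y\<in>neighbours G z. (f z - f y)\<^sup>2) \<le> (\<Sum>y\<in>hood z. (f z - f y)\<^sup>2)"
    using finite_hood by (intro sum_mono2) (auto simp: hood_def)
  also have "\<dots> \<le> (\<Sum>y\<in>hood z. 2 * (f y - c)\<^sup>2 + 2 * (f z - c)\<^sup>2)"
  proof (intro sum_mono)
    fix y
    have "0 \<le> ((f z - c) + (f y - c))\<^sup>2" by simp
    then show "(f z - f y)\<^sup>2 \<le> 2 * (f y - c)\<^sup>2 + 2 * (f z - c)\<^sup>2"
      by (simp add: power2_eq_square algebra_simps)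
  qed
  also have "\<dots> = 2 * V + 2 * mass z * (f z - c)\<^sup>2"
    by (simp add: sum.distrib sum_distrib_left V_def card_hood)
  also have "\<dots> \<le> 2 * V + 2 * (real D + 1) * V"
    using zV V0 mass_le[of z] mass_pos[of z] by (intro add_mono mult_mono) auto
  also have "\<dots> = V * (2 * (real D + 2))" by (simp add: algebra_simps)
  finally have "(\<Sum>y\<in>neighbours G z. (f z - f y)\<^sup>2) / (2 * (real D + 2)) \<le> V"
    by (simp add: divide_le_eq)
  then show ?thesis using V_eq by (simp add: c_def)
qed

definition arcs_at :: "'a set \<Rightarrow> ('a \<times> 'a) set" where
  "arcs_at S = {(x, y) \<in> parcs G. x \<in> S \<or> y \<in> S}"

lemma arcs_at_eq: "arcs_at S = Sigma S (neighbours G) \<union> prod.swap ` Sigma S (neighbours G)"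
  using arc_sym by (auto simp: arcs_at_def neighbours_def image_iff)

lemma finite_arcs_at: "finite S \<Longrightarrow> finite (arcs_at S)"
  using finite_neighbours by (auto simp: arcs_at_eq)

text \<open>Summation of \<open>variance_bound\<close> over \<open>T\<close>. Since \<open>T\<close>
  contains \<open>hood y\<close> for all \<open>y\<close> in \<open>S\<close>, exchanging the sums
  counts \<open>(f y)\<^sup>2\<close> exactly \<open>mass y\<close> times, and every arc touching
  \<open>S\<close> starts in \<open>T\<close>.\<close>

lemma energy_decay:
  assumes S: "finite S" and f0: "\<And>x. x \<notin> S \<Longrightarrow> f x = 0"
    and T: "finite T" "(\<Union>x\<in>S. hood x) \<subseteq> T"
  shows "(\<Sum>z\<in>T. mass z * (avg f z)\<^sup>2) \<le> (\<Sum>z\<in>S. mass z * (f z)\<^sup>2)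
    - (\<Sum>(x, y)\<in>arcs_at S. (f x - f y)\<^sup>2) / (2 * (real D + 2))"
proof -
  have ST: "S \<subseteq> T" using T self_in_hood by blast
  have "(\<Sum>z\<in>T. \<Sum>y\<in>hood z. (f y)\<^sup>2) = (\<Sum>z\<in>T. \<Sum>y\<in>{y \<in> S. y \<in> hood z}. (f y)\<^sup>2)"
  proof (intro sum.cong[OF refl])
    fix z
    show "(\<Sum>y\<in>hood z. (f y)\<^sup>2) = (\<Sum>y\<in>{y \<in> S. y \<in> hood z}. (f y)\<^sup>2)"
      using f0 by (intro sum.mono_neutral_right finite_hood) auto
  qed
  also have "\<dots> = (\<Sum>y\<in>S. \<Sum>z\<in>{z \<in> T. y \<in> hood z}. (f y)\<^sup>2)"
    using S T by (intro sum.swap_restrict) auto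
  also have "\<dots> = (\<Sum>y\<in>S. mass y * (f y)\<^sup>2)"
  proof (intro sum.cong refl)
    fix y assume "y \<in> S"
    then have "{z \<in> T. y \<in> hood z} = hood y" using T hood_sym by blast
    then show "(\<Sum>z\<in>{z \<in> T. y \<in> hood z}. (f y)\<^sup>2) = mass y * (f y)\<^sup>2"
      by (simp add: card_hood)
  qed
  finally have A: "(\<Sum>z\<in>T. \<Sum>y\<in>hood z. (f y)\<^sup>2) = (\<Sum>y\<in>S. mass y * (f y)\<^sup>2)" .
  have "(\<Sum>(x, y)\<in>arcs_at S. (f x - f y)\<^sup>2) \<le> (\<Sum>(x, y)\<in>Sigma T (neighbours G). (f x - f y)\<^sup>2)"
  proof (intro sum_mono2)
    show "finite (Sigma T (neighbours G))" using T finite_neighbours by auto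
    show "arcs_at S \<subseteq> Sigma T (neighbours G)"
    proof -
      have "y \<in> T" if "x \<in> S" "(x, y) \<in> parcs G" for x y
        using T(2) that by (auto simp: hood_def neighbours_def)
      then show ?thesis using ST arc_sym by (fastforce simp: arcs_at_def neighbours_def)
    qed
  qed auto
  also have "\<dots> = (\<Sum>x\<in>T. \<Sum>y\<in>neighbours G x. (f x - f y)\<^sup>2)"
    using T finite_neighbours by (intro sum.Sigma[symmetric]) auto
  finally have B: "(\<Sum>(x, y)\<in>arcs_at S. (f x - f y)\<^sup>2) / (2 * (real D + 2))
      \<le> (\<Sum>x\<in>T. (\<Sum>y\<in>neighbours G x. (f x - f y)\<^sup>2) / (2 * (real D + 2)))"
    by (simp add: sum_divide_distrib[symmetric] divide_right_mono)
  have "(\<Sum>z\<in>T. mass z * (avg f z)\<^sup>2) \<le> (\<Sum>z\<in>T. (\<Sum>y\<in>hood z. (f y)\<^sup>2)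
    - (\<Sum>y\<in>neighbours G z. (f z - f y)\<^sup>2) / (2 * (real D + 2)))"
    by (intro sum_mono variance_bound)
  then show ?thesis using A B by (simp add: sum_subtractf)
qed


section \<open>Coarea, Cheeger and Faber-Krahn inequalities\<close>

lemma coarea:
  assumes iso: "\<And>U. U \<subseteq> pverts G \<Longrightarrow> finite U \<Longrightarrow> real (card U) \<le> v \<Longrightarrow>
      real (card U) \<le> H * real (card (edge_boundary G U))"
    and H: "0 \<le> H"
  shows "finite S \<Longrightarrow> S \<subseteq> pverts G \<Longrightarrow> real (card S) \<le> v \<Longrightarrow> (\<And>x. 0 \<le> w x) \<Longrightarrow>
    (\<And>x. x \<notin> S \<Longrightarrow> w x = 0) \<Longrightarrow>
    (\<Sum>x\<in>S. w x) \<le> H * (\<Sum>(x, y)\<in>Sigma S (neighbours G). max 0 (w x - w y))"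
proof (induction "card S" arbitrary: S w rule: less_induct)
  case less
  show ?case
  proof (cases "S = {}")
    case True
    then show ?thesis by simp
  next
    case False
    \<comment> \<open>Layer-cake argument by induction on the support: the isoperimetric inequality
      for \<open>S\<close> pays for the bottom layer of height \<open>t\<close>, and the induction
      hypothesis for the strictly smaller \<open>S'\<close> pays for the rest
      \<open>w'\<close>.\<close>
    define t where "t = Min (w ` S)"
    have t_le: "t \<le> w x" if "x \<in> S" for x
      using that less.prems by (simp add: t_def)
    obtain x0 where x0: "x0 \<in> S" "w x0 = t"
    proof -
      have "t \<in> w ` S" unfolding t_def using less.prems False by (intro Min_in) auto
      then show thesis using that by auto
    qed
    have t0: "0 \<le> t" using x0 less.prems(4)[of x0] by simp
    define S' where "S' = {x \<in> S. t < w x}"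
    define w' where "w' x = (if x \<in> S then w x - t else 0)" for x
    have fS': "finite S'" and sub: "S' \<subseteq> S" using less.prems by (auto simp: S'_def)
    have "S' \<subset> S" using x0 by (auto simp: S'_def)
    then have lt: "card S' < card S" using less.prems by (intro psubset_card_mono) auto
    have fin: "finite (Sigma S (neighbours G))" using less.prems finite_neighbours by auto
    have w'0: "w' x = 0" if "x \<notin> S'" for x
      using that t_le[of x] by (auto simp: S'_def w'_def)
    have IH: "(\<Sum>x\<in>S'. w' x) \<le> H * (\<Sum>(x, y)\<in>Sigma S' (neighbours G). max 0 (w' x - w' y))"
    proof (rule less.hyps[OF lt fS'])
      show "S' \<subseteq> pverts G" using sub less.prems by auto
      show "real (card S') \<le> v" using lt less.prems by linarith
      show "0 \<le> w' x" for x using t_le[of x] by (auto simp: w'_def)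
    qed (rule w'0)
    have bd: "edge_boundary G S = {(x, y) \<in> Sigma S (neighbours G). y \<notin> S}"
      using arc_verts by (auto simp: edge_boundary_def neighbours_def)
    \<comment> \<open>Lowering \<open>w\<close> by \<open>t\<close> on \<open>S\<close> alters the
      increments only along arcs that leave \<open>S\<close>, each by exactly
      \<open>t\<close>.\<close>
    have "(\<Sum>(x, y)\<in>Sigma S (neighbours G). max 0 (w x - w y))
        = (\<Sum>(x, y)\<in>Sigma S (neighbours G). max 0 (w' x - w' y) + (if y \<notin> S then t else 0))"
    proof (intro sum.cong refl)
      fix e assume "e \<in> Sigma S (neighbours G)"
      then obtain x y where e: "e = (x, y)" "x \<in> S" by auto
      show "(case e of (x, y) \<Rightarrow> max 0 (w x - w y))
        = (case e of (x, y) \<Rightarrow> max 0 (w' x - w' y) + (if y \<notin> S then t else 0))"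
        using e t_le[of x] t0 less.prems(5)[of y] by (auto simp: w'_def)
    qed
    also have "\<dots> = (\<Sum>(x, y)\<in>Sigma S (neighbours G). max 0 (w' x - w' y))
        + (\<Sum>(x, y)\<in>Sigma S (neighbours G). if y \<notin> S then t else 0)"
      by (simp add: sum.distrib case_prod_unfold)
    also have "(\<Sum>(x, y)\<in>Sigma S (neighbours G). if y \<notin> S then t else 0) = t * real (card (edge_boundary G S))"
    proof -
      have "(\<Sum>(x, y)\<in>Sigma S (neighbours G). if y \<notin> S then t else 0)
        = (\<Sum>e\<in>Sigma S (neighbours G). if snd e \<notin> S then t else 0)" by (simp add: case_prod_unfold)
      also have "\<dots> = (\<Sum>e\<in>{e \<in> Sigma S (neighbours G). snd e \<notin> S}. t)"
        by (rule sum.inter_filter[OF fin, symmetric])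
      also have "{e \<in> Sigma S (neighbours G). snd e \<notin> S} = edge_boundary G S"
        unfolding bd by auto
      finally show ?thesis by simp
    qed
    also have "(\<Sum>(x, y)\<in>Sigma S (neighbours G). max 0 (w' x - w' y))
        = (\<Sum>(x, y)\<in>Sigma S' (neighbours G). max 0 (w' x - w' y))"
    proof (rule sum.mono_neutral_right[OF fin])
      show "Sigma S' (neighbours G) \<subseteq> Sigma S (neighbours G)" using sub by auto
      show "\<forall>e\<in>Sigma S (neighbours G) - Sigma S' (neighbours G). (case e of (x, y) \<Rightarrow> max 0 (w' x - w' y)) = 0"
      proof
        fix e assume "e \<in> Sigma S (neighbours G) - Sigma S' (neighbours G)"
        then obtain x y where e: "e = (x, y)" "x \<notin> S'" by auto
        have "0 \<le> w' y" using t_le[of y] by (auto simp: w'_def)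
        then show "(case e of (x, y) \<Rightarrow> max 0 (w' x - w' y)) = 0" using e w'0[of x] by simp
      qed
    qed
    finally have rhs: "(\<Sum>(x, y)\<in>Sigma S (neighbours G). max 0 (w x - w y))
      = (\<Sum>(x, y)\<in>Sigma S' (neighbours G). max 0 (w' x - w' y)) + t * real (card (edge_boundary G S))" .
    have "(\<Sum>x\<in>S. w x) = (\<Sum>x\<in>S. w' x + t)"
      by (intro sum.cong) (auto simp: w'_def)
    also have "\<dots> = (\<Sum>x\<in>S. w' x) + t * real (card S)" by (simp add: sum.distrib)
    also have "(\<Sum>x\<in>S. w' x) = (\<Sum>x\<in>S'. w' x)"
      using less.prems sub w'0 by (intro sum.mono_neutral_right) auto
    finally have lhs: "(\<Sum>x\<in>S. w x) = (\<Sum>x\<in>S'. w' x) + t * real (card S)" .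
    have "t * real (card S) \<le> t * (H * real (card (edge_boundary G S)))"
      using iso[of S] less.prems t0 by (intro mult_left_mono) auto
    then show ?thesis unfolding lhs rhs using IH by (simp add: algebra_simps)
  qed
qed

text \<open>Coarea is applied to the square of \<open>g\<close>. The increment factors as
  \<open>(g x - g y) * (g x + g y)\<close>, and Cauchy-Schwarz separates the Dirichlet energy from a
  second factor of at most \<open>4 * real D * Q\<close>. One \<open>Q\<close> is then
  cancelled.\<close>

lemma cheeger:
  assumes iso: "\<And>U. U \<subseteq> pverts G \<Longrightarrow> finite U \<Longrightarrow> real (card U) \<le> v \<Longrightarrow>
      real (card U) \<le> H * real (card (edge_boundary G U))"
    and H: "0 \<le> H" and S: "finite S" "S \<subseteq> pverts G" "real (card S) \<le> v"
    and g: "\<And>x. 0 \<le> g x" "\<And>x. x \<notin> S \<Longrightarrow> g x = 0"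
  shows "(\<Sum>x\<in>S. (g x)\<^sup>2) \<le> 4 * real D * H\<^sup>2 * (\<Sum>(x, y)\<in>arcs_at S. (g x - g y)\<^sup>2)"
proof -
  define E where "E = (\<Sum>(x, y)\<in>arcs_at S. (g x - g y)\<^sup>2)"
  define Q where "Q = (\<Sum>x\<in>S. (g x)\<^sup>2)"
  have fin: "finite (arcs_at S)" using S finite_arcs_at by simp
  have Q0: "0 \<le> Q" and E0: "0 \<le> E" by (auto simp: Q_def E_def intro!: sum_nonneg)
  have "Q \<le> H * (\<Sum>(x, y)\<in>Sigma S (neighbours G). max 0 ((g x)\<^sup>2 - (g y)\<^sup>2))"
    unfolding Q_def using coarea[OF iso H S, of "\<lambda>x. (g x)\<^sup>2"] g by simp
  also have "\<dots> \<le> H * (\<Sum>(x, y)\<in>arcs_at S. \<bar>g x - g y\<bar> * (g x + g y))"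
  proof (intro mult_left_mono H)
    have "(\<Sum>(x, y)\<in>Sigma S (neighbours G). max 0 ((g x)\<^sup>2 - (g y)\<^sup>2))
      \<le> (\<Sum>(x, y)\<in>Sigma S (neighbours G). \<bar>g x - g y\<bar> * (g x + g y))"
    proof (intro sum_mono)
      fix e
      have "max 0 ((g x)\<^sup>2 - (g y)\<^sup>2) \<le> \<bar>g x - g y\<bar> * (g x + g y)" for x y
      proof -
        have "(g x)\<^sup>2 - (g y)\<^sup>2 = (g x - g y) * (g x + g y)"
          by (simp add: power2_eq_square algebra_simps)
        then show ?thesis using g(1)[of x] g(1)[of y]
          by (auto intro!: mult_right_mono)
      qed
      then show "(case e of (x, y) \<Rightarrow> max 0 ((g x)\<^sup>2 - (g y)\<^sup>2))
        \<le> (case e of (x, y) \<Rightarrow> \<bar>g x - g y\<bar> * (g x + g y))" by (simp add: case_prod_unfold)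
    qed
    also have "\<dots> \<le> (\<Sum>(x, y)\<in>arcs_at S. \<bar>g x - g y\<bar> * (g x + g y))"
      using g fin by (intro sum_mono2) (auto simp: arcs_at_eq)
    finally show "(\<Sum>(x, y)\<in>Sigma S (neighbours G). max 0 ((g x)\<^sup>2 - (g y)\<^sup>2))
      \<le> (\<Sum>(x, y)\<in>arcs_at S. \<bar>g x - g y\<bar> * (g x + g y))" .
  qed
  finally have Q1: "Q \<le> H * (\<Sum>(x, y)\<in>arcs_at S. \<bar>g x - g y\<bar> * (g x + g y))" .
  have "(\<Sum>(x, y)\<in>arcs_at S. \<bar>g x - g y\<bar> * (g x + g y))\<^sup>2
      \<le> (\<Sum>(x, y)\<in>arcs_at S. \<bar>g x - g y\<bar>\<^sup>2) * (\<Sum>(x, y)\<in>arcs_at S. (g x + g y)\<^sup>2)"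
    unfolding case_prod_unfold by (rule Cauchy_Schwarz_ineq_sum)
  then have CS: "(\<Sum>(x, y)\<in>arcs_at S. \<bar>g x - g y\<bar> * (g x + g y))\<^sup>2
      \<le> E * (\<Sum>(x, y)\<in>arcs_at S. (g x + g y)\<^sup>2)" by (simp add: E_def)
  have deg: "(\<Sum>(x, y)\<in>arcs_at S. (g x)\<^sup>2) \<le> real D * Q" "(\<Sum>(x, y)\<in>arcs_at S. (g y)\<^sup>2) \<le> real D * Q"
  proof -
    have fS: "finite (Sigma S (neighbours G))" using S finite_neighbours by auto
    have "(\<Sum>(x, y)\<in>Sigma S (neighbours G). (g x)\<^sup>2) = (\<Sum>x\<in>S. real (valency G x) * (g x)\<^sup>2)"
      using S finite_neighbours by (subst sum.Sigma[symmetric]) (auto simp: valency_def)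
    also have "\<dots> \<le> (\<Sum>x\<in>S. real D * (g x)\<^sup>2)"
      using valency_bound by (intro sum_mono mult_right_mono) auto
    finally have b: "(\<Sum>(x, y)\<in>Sigma S (neighbours G). (g x)\<^sup>2) \<le> real D * Q"
      by (simp add: Q_def sum_distrib_left)
    have sw: "(\<Sum>(x, y)\<in>arcs_at S. (g y)\<^sup>2) = (\<Sum>(x, y)\<in>arcs_at S. (g x)\<^sup>2)"
      by (rule sum.reindex_bij_witness[of _ prod.swap prod.swap]) (auto simp: arcs_at_def dest: arc_sym)
    have "(\<Sum>(x, y)\<in>arcs_at S. (g x)\<^sup>2) = (\<Sum>(x, y)\<in>Sigma S (neighbours G). (g x)\<^sup>2)"
    proof (rule sum.mono_neutral_right[OF fin])
      show "\<forall>e\<in>arcs_at S - Sigma S (neighbours G). (case e of (x, y) \<Rightarrow> (g x)\<^sup>2) = 0"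
      proof
        fix e assume "e \<in> arcs_at S - Sigma S (neighbours G)"
        then have "fst e \<notin> S" by (auto simp: arcs_at_def neighbours_def)
        then show "(case e of (x, y) \<Rightarrow> (g x)\<^sup>2) = 0" using g by (simp add: case_prod_unfold)
      qed
    qed (auto simp: arcs_at_eq)
    then show "(\<Sum>(x, y)\<in>arcs_at S. (g x)\<^sup>2) \<le> real D * Q" "(\<Sum>(x, y)\<in>arcs_at S. (g y)\<^sup>2) \<le> real D * Q"
      using b sw by auto
  qed
  have "(\<Sum>(x, y)\<in>arcs_at S. (g x + g y)\<^sup>2) \<le> (\<Sum>(x, y)\<in>arcs_at S. 2 * (g x)\<^sup>2 + 2 * (g y)\<^sup>2)"
  proof (intro sum_mono)
    fix e
    have "(g x + g y)\<^sup>2 \<le> 2 * (g x)\<^sup>2 + 2 * (g y)\<^sup>2" for x y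
      using zero_le_power2[of "g x - g y"] by (simp add: power2_eq_square algebra_simps)
    then show "(case e of (x, y) \<Rightarrow> (g x + g y)\<^sup>2) \<le> (case e of (x, y) \<Rightarrow> 2 * (g x)\<^sup>2 + 2 * (g y)\<^sup>2)"
      by (simp add: case_prod_unfold)
  qed
  also have "\<dots> = 2 * (\<Sum>(x, y)\<in>arcs_at S. (g x)\<^sup>2) + 2 * (\<Sum>(x, y)\<in>arcs_at S. (g y)\<^sup>2)"
    by (simp add: sum.distrib sum_distrib_left case_prod_unfold)
  also have "\<dots> \<le> 4 * real D * Q" using deg by simp
  finally have "(\<Sum>(x, y)\<in>arcs_at S. \<bar>g x - g y\<bar> * (g x + g y))\<^sup>2 \<le> E * (4 * real D * Q)"
    using CS E0 by (meson mult_left_mono order_trans)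
  then have "H\<^sup>2 * (\<Sum>(x, y)\<in>arcs_at S. \<bar>g x - g y\<bar> * (g x + g y))\<^sup>2 \<le> H\<^sup>2 * (E * (4 * real D * Q))"
    by (intro mult_left_mono) auto
  moreover have "Q\<^sup>2 \<le> H\<^sup>2 * (\<Sum>(x, y)\<in>arcs_at S. \<bar>g x - g y\<bar> * (g x + g y))\<^sup>2"
    using power_mono[OF Q1 Q0, of 2] by (simp add: power_mult_distrib)
  ultimately have "Q * Q \<le> (4 * real D * H\<^sup>2 * E) * Q"
    by (simp add: power2_eq_square mult_ac)
  then have "Q = 0 \<or> Q \<le> 4 * real D * H\<^sup>2 * E"
    using Q0 by (metis less_eq_real_def mult_le_cancel_right_pos)
  then show ?thesis using E0 unfolding Q_def[symmetric] E_def[symmetric] by auto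
qed

text \<open>Truncation at \<open>t = w / 4\<close>: since \<open>f\<close> sums to at most 1, it
  exceeds \<open>t\<close> at no more than \<open>4 / w\<close> points, so Cheeger's inequality
  applies to \<open>g\<close>. As \<open>(f x)\<^sup>2 \<le> (g x)\<^sup>2 + 2 * t * f x\<close>,
  truncating costs at most \<open>w / 2\<close>, which doubles the constant 4 to 8.\<close>

lemma faber_krahn:
  assumes iso: "\<And>U. U \<subseteq> pverts G \<Longrightarrow> finite U \<Longrightarrow> real (card U) \<le> v \<Longrightarrow>
      real (card U) \<le> H * real (card (edge_boundary G U))"
    and H: "0 \<le> H" and S: "finite S" "S \<subseteq> pverts G"
    and f: "\<And>x. 0 \<le> f x" "\<And>x. x \<notin> S \<Longrightarrow> f x = 0" and f1: "(\<Sum>x\<in>S. f x) \<le> 1"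
    and w: "w = (\<Sum>x\<in>S. (f x)\<^sup>2)" "0 < w" "4 / w \<le> v"
  shows "w \<le> 8 * real D * H\<^sup>2 * (\<Sum>(x, y)\<in>arcs_at S. (f x - f y)\<^sup>2)"
proof -
  define t where "t = w / 4"
  have t0: "0 < t" using w by (simp add: t_def)
  define g where "g x = max 0 (f x - t)" for x
  define S' where "S' = {x \<in> S. t < f x}"
  have S': "finite S'" "S' \<subseteq> S" "S' \<subseteq> pverts G" using S by (auto simp: S'_def)
  have "t * real (card S') = (\<Sum>x\<in>S'. t)" by simp
  also have "\<dots> \<le> (\<Sum>x\<in>S'. f x)" by (intro sum_mono) (auto simp: S'_def)
  also have "\<dots> \<le> (\<Sum>x\<in>S. f x)" using S S' f by (intro sum_mono2) auto
  finally have "t * real (card S') \<le> 1" using f1 by simp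
  then have "real (card S') \<le> 4 / w" using w(2) by (simp add: t_def field_simps)
  then have "real (card S') \<le> v" using w(3) by simp
  then have ch: "(\<Sum>x\<in>S'. (g x)\<^sup>2) \<le> 4 * real D * H\<^sup>2 * (\<Sum>(x, y)\<in>arcs_at S'. (g x - g y)\<^sup>2)"
    using f(2) t0 by (intro cheeger[OF iso H S'(1) S'(3)]) (auto simp: g_def S'_def)
  have "w \<le> (\<Sum>x\<in>S. (g x)\<^sup>2 + 2 * t * f x)"
    unfolding w(1)
  proof (intro sum_mono)
    fix x
    show "(f x)\<^sup>2 \<le> (g x)\<^sup>2 + 2 * t * f x"
    proof (cases "f x \<le> t")
      case True
      then have "f x * f x \<le> t * f x" using f by (intro mult_right_mono) auto
      moreover have "0 \<le> t * f x" using t0 f by simp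
      ultimately show ?thesis using True by (simp add: g_def power2_eq_square)
    next
      case False
      then show ?thesis by (simp add: g_def power2_eq_square algebra_simps)
    qed
  qed
  also have "\<dots> = (\<Sum>x\<in>S. (g x)\<^sup>2) + 2 * t * (\<Sum>x\<in>S. f x)"
    by (simp add: sum.distrib sum_distrib_left)
  also have "\<dots> \<le> (\<Sum>x\<in>S. (g x)\<^sup>2) + w / 2"
    using f1 t0 mult_left_mono[OF f1, of "2 * t"] by (simp add: t_def)
  also have "(\<Sum>x\<in>S. (g x)\<^sup>2) = (\<Sum>x\<in>S'. (g x)\<^sup>2)"
    using S S' by (intro sum.mono_neutral_right) (auto simp: g_def S'_def)
  finally have "w / 2 \<le> (\<Sum>x\<in>S'. (g x)\<^sup>2)" by simp
  moreover have "(\<Sum>(x, y)\<in>arcs_at S'. (g x - g y)\<^sup>2) \<le> (\<Sum>(x, y)\<in>arcs_at S. (f x - f y)\<^sup>2)"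
  proof -
    have "(\<Sum>(x, y)\<in>arcs_at S'. (g x - g y)\<^sup>2) \<le> (\<Sum>(x, y)\<in>arcs_at S. (g x - g y)\<^sup>2)"
      using S S' finite_arcs_at by (intro sum_mono2) (auto simp: arcs_at_def)
    also have "\<dots> \<le> (\<Sum>(x, y)\<in>arcs_at S. (f x - f y)\<^sup>2)"
    proof (intro sum_mono)
      fix e
      have "(g x - g y)\<^sup>2 \<le> (f x - f y)\<^sup>2" for x y
        by (rule abs_le_square_iff[THEN iffD1]) (auto simp: g_def)
      then show "(case e of (x, y) \<Rightarrow> (g x - g y)\<^sup>2) \<le> (case e of (x, y) \<Rightarrow> (f x - f y)\<^sup>2)"
        by (simp add: case_prod_unfold)
    qed
    finally show ?thesis .
  qed
  then have "4 * real D * H\<^sup>2 * (\<Sum>(x, y)\<in>arcs_at S'. (g x - g y)\<^sup>2)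
      \<le> 4 * real D * H\<^sup>2 * (\<Sum>(x, y)\<in>arcs_at S. (f x - f y)\<^sup>2)"
    by (intro mult_left_mono) auto
  ultimately show ?thesis using ch by simp
qed

text \<open>Nash-type argument for the squared norm \<open>u n\<close> of the density. While
  \<open>u n\<close> exceeds the threshold, Faber-Krahn applies and one step shrinks
  \<open>u\<close> by the factor \<open>exp (- c)\<close>; below the threshold monotonicity
  suffices.\<close>

lemma return_probability_upper:
  assumes iso: "\<And>U. U \<subseteq> pverts G \<Longrightarrow> finite U \<Longrightarrow> real (card U) \<le> v \<Longrightarrow>
      real (card U) \<le> H * real (card (edge_boundary G U))"
    and H: "0 < H" and v: "0 < v" and x: "x \<in> pverts G"
  shows "pmf (walk G (2 * n) x) x
    \<le> (real D + 1) * max (4 * (real D + 1) / v) (exp (- real n / (16 * (real D + 2) ^ 3 * H\<^sup>2)))"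
proof -
  define f where "f n y = pmf (walk G n x) y / mass y" for n y
  define A where "A n = set_pmf (walk G n x)" for n
  define u where "u n = (\<Sum>y\<in>A n. mass y * (f n y)\<^sup>2)" for n
  \<comment> \<open>\<open>c\<close> collects \<open>8 * real D * H\<^sup>2\<close> from
    Faber-Krahn, \<open>real D + 1\<close> from the bound on \<open>mass\<close>, and
    \<open>2 * (real D + 2)\<close> from \<open>energy_decay\<close>, with the first two valency
    factors rounded up to \<open>real D + 2\<close>.\<close>
  define c where "c = 1 / (16 * (real D + 2) ^ 3 * H\<^sup>2)"
  have finA: "finite (A n)" and subA: "A n \<subseteq> pverts G" for n
    using finite_set_walk set_walk_verts[OF x] by (auto simp: A_def)
  have f0: "y \<notin> A n \<Longrightarrow> f n y = 0" and fnn: "0 \<le> f n y" for n y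
    using mass_pos[of y] by (auto simp: A_def f_def set_pmf_iff)
  have u_eq: "u n = (\<Sum>y\<in>A n. (pmf (walk G n x) y)\<^sup>2 / mass y)" for n
    unfolding u_def using mass_pos
    by (intro sum.cong) (auto simp: f_def power_divide power2_eq_square less_imp_neq[symmetric])
  have p_eq: "pmf (walk G (2 * n) x) x = mass x * u n" for n
    unfolding u_eq using walk_double[of "A n" n x] finA by (simp add: A_def)
  have u_pos: "0 < u n" for n
  proof -
    have "0 < pmf (walk G (2 * n) x) x"
      using walk_return_ge[of "2 * n" x] by (rule less_le_trans[rotated]) simp
    then show ?thesis using mass_pos[of x] by (simp add: p_eq zero_less_mult_iff)
  qed
  have f_Suc: "f (Suc n) = avg (f n)" for n
    by (auto simp: f_def avg_def walk_Suc_sum simp del: walk.simps)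
  have A_Suc: "A (Suc n) = (\<Union>y\<in>A n. hood y)" for n
    by (simp add: A_def set_walk_step)
  have decay: "u (Suc n) \<le> u n - (\<Sum>(x, y)\<in>arcs_at (A n). (f n x - f n y)\<^sup>2) / (2 * (real D + 2))" for n
    unfolding u_def f_Suc by (rule energy_decay[OF finA f0 finA]) (auto simp: A_Suc)
  have u_mono: "u (Suc n) \<le> u n" for n
  proof -
    have "0 \<le> (\<Sum>(x, y)\<in>arcs_at (A n). (f n x - f n y)\<^sup>2) / (2 * (real D + 2))"
      by (intro divide_nonneg_nonneg sum_nonneg) auto
    then show ?thesis using decay[of n] by linarith
  qed
  have u0: "u 0 \<le> 1"
    using mass_ge_1[of x] by (simp add: u_eq A_def)
  have step: "u (Suc m) \<le> u m * exp (- c)" if big: "4 * (real D + 1) / v < u m" for m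
  proof -
    define w where "w = (\<Sum>y\<in>A m. (f m y)\<^sup>2)"
    define E where "E = (\<Sum>(x, y)\<in>arcs_at (A m). (f m x - f m y)\<^sup>2)"
    have E0: "0 \<le> E" by (auto simp: E_def intro!: sum_nonneg)
    have uw: "u m \<le> (real D + 1) * w"
      unfolding u_def w_def sum_distrib_left using mass_le by (intro sum_mono mult_right_mono) auto
    have "0 < (real D + 1) * w" using uw u_pos[of m] by linarith
    then have w0: "0 < w" by (simp add: zero_less_mult_iff)
    have "4 * (real D + 1) / v < (real D + 1) * w" using big uw by linarith
    then have "(real D + 1) * (4 / v) < (real D + 1) * w"
      by (simp only: times_divide_eq_right mult.commute[of 4])
    moreover have "0 < real D + 1" by simp
    ultimately have "4 / v < w" by (blast dest: mult_less_cancel_left_pos[THEN iffD1])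
    then have wv: "4 / w \<le> v" using v w0 by (simp add: field_simps)
    have "(\<Sum>y\<in>A m. f m y) \<le> (\<Sum>y\<in>A m. pmf (walk G m x) y)"
    proof (intro sum_mono)
      fix y show "f m y \<le> pmf (walk G m x) y"
        using mass_ge_1[of y] by (simp add: f_def divide_le_eq mult_le_cancel_left1)
    qed
    also have "\<dots> = 1" using finA by (intro sum_pmf_eq_1) (auto simp: A_def)
    finally have f1: "(\<Sum>y\<in>A m. f m y) \<le> 1" .
    have "w \<le> 8 * real D * H\<^sup>2 * E"
      unfolding E_def using faber_krahn[OF iso less_imp_le[OF H] finA subA fnn f0 f1 w_def w0 wv] .
    also have "\<dots> \<le> 8 * (real D + 2) * H\<^sup>2 * E" using E0 by (intro mult_right_mono) auto
    finally have wE: "w \<le> 8 * (real D + 2) * H\<^sup>2 * E" .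
    have "u m \<le> (real D + 2) * (8 * (real D + 2) * H\<^sup>2 * E)"
      using uw w0 by (intro order_trans[OF uw] mult_mono wE) auto
    then have "c * u m \<le> c * ((real D + 2) * (8 * (real D + 2) * H\<^sup>2 * E))"
      by (intro mult_left_mono) (auto simp: c_def)
    also have "\<dots> = E / (2 * (real D + 2))"
    proof -
      have "1 / (16 * a ^ 3 * H\<^sup>2) * (a * (8 * a * H\<^sup>2 * E)) = E / (2 * a)" if "0 < a" for a
        using that H by (simp add: field_simps power2_eq_square power3_eq_cube)
      from this[of "real D + 2"] show ?thesis by (simp add: c_def)
    qed
    finally have "u (Suc m) \<le> u m * (1 - c)"
      using decay[of m] by (simp add: E_def algebra_simps)
    also have "\<dots> \<le> u m * exp (- c)"
      using exp_ge_add_one_self[of "- c"] u_pos[of m] by (intro mult_left_mono) auto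
    finally show ?thesis .
  qed
  have "u n \<le> max (4 * (real D + 1) / v) (exp (- c * real n))"
  proof (induction n)
    case 0
    show ?case using u0 by simp
  next
    case (Suc n)
    show ?case
    proof (cases "4 * (real D + 1) / v < u n")
      case True
      then have "u n \<le> exp (- c * real n)" using Suc by auto
      then have "u n * exp (- c) \<le> exp (- c * real n) * exp (- c)" by (intro mult_right_mono) auto
      then show ?thesis using step[OF True] by (auto simp: exp_add[symmetric] algebra_simps)
    next
      case False
      then show ?thesis using u_mono[of n] by (auto simp: max_def)
    qed
  qed
  then have "mass x * u n \<le> (real D + 1) * max (4 * (real D + 1) / v) (exp (- c * real n))"
    using mass_le[of x] u_pos[of n] by (intro mult_mono) auto
  then show ?thesis by (simp add: p_eq c_def)
qed

text \<open>Iterating \<open>sub\<close> bounds \<open>c ^ n * f x\<close> by the mean of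
  \<open>f\<close> at time \<open>n\<close>, hence by the probability of being in \<open>B\<close>.
  Cauchy-Schwarz over \<open>B\<close> turns this into a bound on the l2 norm of the law, which
  \<open>walk_double\<close> relates to the return probability.\<close>

lemma return_probability_lower:
  assumes B: "finite B" and f: "\<And>y. y \<notin> B \<Longrightarrow> f y = 0" "\<And>y. 0 \<le> f y" "\<And>y. f y \<le> 1"
    and c: "0 \<le> c" and sub: "\<And>y. c * f y \<le> avg f y"
  shows "(c ^ n * f x)\<^sup>2 \<le> (real D + 1) * real (card B) * pmf (walk G (2 * n) x) x"
proof -
  define A where "A = B \<union> set_pmf (walk G n x)"
  have A: "finite A" "set_pmf (walk G n x) \<subseteq> A" "B \<subseteq> A" using B finite_set_walk by (auto simp: A_def)
  have "c ^ n * f x \<le> (\<Sum>y\<in>B. pmf (walk G n x) y * f y)"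
  proof (induction n arbitrary: x)
    case 0
    show ?case
    proof (cases "x \<in> B")
      case True
      then have "(\<Sum>y\<in>B. pmf (walk G 0 x) y * f y) = (\<Sum>y\<in>B. if y = x then f y else 0)"
        by (intro sum.cong) (auto simp: indicator_def)
      then show ?thesis using True B by simp
    qed (simp add: f sum_nonneg)
  next
    case (Suc n)
    have "c ^ Suc n * f x \<le> c ^ n * avg f x"
      using mult_left_mono[OF sub[of x], of "c ^ n"] c by (simp add: mult_ac)
    also have "\<dots> = (\<Sum>z\<in>hood x. c ^ n * f z) / mass x"
      by (simp add: avg_def sum_distrib_left)
    also have "\<dots> \<le> (\<Sum>z\<in>hood x. \<Sum>y\<in>B. pmf (walk G n z) y * f y) / mass x"
      using Suc mass_pos[of x] by (intro divide_right_mono sum_mono) auto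
    also have "\<dots> = (\<Sum>y\<in>B. pmf (walk G (Suc n) x) y * f y)"
      unfolding walk_Suc_first avg_def
      by (subst sum.swap) (simp add: sum_divide_distrib sum_distrib_right)
    finally show ?case .
  qed
  also have "\<dots> \<le> (\<Sum>y\<in>B. pmf (walk G n x) y)"
    using f by (intro sum_mono) (simp add: mult_left_le)
  finally have "(c ^ n * f x)\<^sup>2 \<le> (\<Sum>y\<in>B. 1 * pmf (walk G n x) y)\<^sup>2"
    using c f by (intro power_mono) auto
  also have "\<dots> \<le> (\<Sum>y\<in>B. 1\<^sup>2) * (\<Sum>y\<in>B. (pmf (walk G n x) y)\<^sup>2)"
    by (rule Cauchy_Schwarz_ineq_sum)
  also have "\<dots> \<le> real (card B) * (\<Sum>y\<in>A. (pmf (walk G n x) y)\<^sup>2)"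
    using A by (auto intro!: mult_left_mono sum_mono2)
  also have "\<dots> \<le> real (card B) * ((real D + 1) * pmf (walk G (2 * n) x) x)"
  proof (intro mult_left_mono)
    have "(\<Sum>y\<in>A. (pmf (walk G n x) y)\<^sup>2)
        \<le> (\<Sum>y\<in>A. (real D + 1) * ((pmf (walk G n x) y)\<^sup>2 / mass y))"
    proof (intro sum_mono)
      fix y
      have "mass y * (pmf (walk G n x) y)\<^sup>2 \<le> (real D + 1) * (pmf (walk G n x) y)\<^sup>2"
        using mass_le by (intro mult_right_mono) auto
      then show "(pmf (walk G n x) y)\<^sup>2 \<le> (real D + 1) * ((pmf (walk G n x) y)\<^sup>2 / mass y)"
        using mass_pos[of y] by (simp add: field_simps)
    qed
    also have "\<dots> \<le> (real D + 1) * (mass x * (\<Sum>y\<in>A. (pmf (walk G n x) y)\<^sup>2 / mass y))"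
    proof -
      have "0 \<le> (\<Sum>y\<in>A. (pmf (walk G n x) y)\<^sup>2 / mass y)"
        using mass_pos by (intro sum_nonneg) (simp add: less_imp_le)
      then have "1 * (\<Sum>y\<in>A. (pmf (walk G n x) y)\<^sup>2 / mass y)
          \<le> mass x * (\<Sum>y\<in>A. (pmf (walk G n x) y)\<^sup>2 / mass y)"
        using mass_ge_1[of x] by (intro mult_right_mono) auto
      then show ?thesis unfolding sum_distrib_left[symmetric] by (intro mult_left_mono) auto
    qed
    finally show "(\<Sum>y\<in>A. (pmf (walk G n x) y)\<^sup>2) \<le> (real D + 1) * pmf (walk G (2 * n) x) x"
      by (simp add: walk_double[OF A(1,2)])
  qed auto
  finally show ?thesis by (simp add: mult_ac)
qed

end

section \<open>Permutations expanding small sets\<close>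

definition perms_into :: "'a set \<Rightarrow> 'a set \<Rightarrow> 'a set \<Rightarrow> ('a \<Rightarrow> 'a) set" where
  "perms_into A S T = {p. p permutes A \<and> p ` S \<subseteq> T}"

lemma finite_perms_into: "finite A \<Longrightarrow> finite (perms_into A S T)"
  by (rule finite_subset[OF _ finite_permutations]) (auto simp: perms_into_def)

text \<open>Double counting of pairs of a permutation sending \<open>S\<close> into \<open>T\<close>
  and a point \<open>z\<close> of \<open>A - S\<close> that it also sends into \<open>T\<close>.
  Each permutation occurs \<open>card T - card S\<close> times; precomposing with the transposition
  of \<open>x\<close> and \<open>z\<close> shows that all \<open>z\<close> occur equally
  often.\<close>

lemma card_perms_into_insert:
  assumes A: "finite A" "S \<subseteq> A" "T \<subseteq> A" "x \<in> A - S"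
  shows "(card A - card S) * card (perms_into A (insert x S) T)
    = (card T - card S) * card (perms_into A S T)"
proof -
  have fin: "finite S" "finite T" using A finite_subset by auto
  have inv: "card (perms_into A (insert z S) T) = card (perms_into A (insert x S) T)" if z: "z \<in> A - S" for z
  proof (rule bij_betw_same_card[of "\<lambda>p. p \<circ> Transposition.transpose x z"],
         rule bij_betw_byWitness[where f' = "\<lambda>p. p \<circ> Transposition.transpose x z"])
    have im: "(p \<circ> Transposition.transpose x z) ` insert z S = p ` insert x S"
        "(p \<circ> Transposition.transpose x z) ` insert x S = p ` insert z S" for p :: "'a \<Rightarrow> 'a"
    proof -
      have "Transposition.transpose x z ` S = S"
        using z A by (force simp: Transposition.transpose_def image_iff)
      then have "(p \<circ> Transposition.transpose x z) ` S = p ` S"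
        by (subst image_comp[symmetric]) (rule arg_cong)
      then show "(p \<circ> Transposition.transpose x z) ` insert z S = p ` insert x S"
        "(p \<circ> Transposition.transpose x z) ` insert x S = p ` insert z S"
        by (simp_all only: image_insert o_apply transpose_apply_first transpose_apply_second)
    qed
    have perm: "p \<circ> Transposition.transpose x z permutes A" if "p permutes A" for p
      using z A by (intro permutes_compose[OF permutes_swap_id that]) auto
    have "p \<circ> Transposition.transpose x z \<in> perms_into A (insert x S) T"
      if "p \<in> perms_into A (insert z S) T" for p
    proof -
      have "p permutes A" "(p \<circ> Transposition.transpose x z) ` insert x S \<subseteq> T"
        using that unfolding perms_into_def im by (simp_all only: mem_Collect_eq)
      then show ?thesis unfolding perms_into_def by (intro CollectI conjI perm)
    qed
    then show "(\<lambda>p. p \<circ> Transposition.transpose x z) ` perms_into A (insert z S) T \<subseteq> perms_into A (insert x S) T"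
      by (rule image_subsetI)
    have "p \<circ> Transposition.transpose x z \<in> perms_into A (insert z S) T"
      if "p \<in> perms_into A (insert x S) T" for p
    proof -
      have "p permutes A" "(p \<circ> Transposition.transpose x z) ` insert z S \<subseteq> T"
        using that unfolding perms_into_def im by (simp_all only: mem_Collect_eq)
      then show ?thesis unfolding perms_into_def by (intro CollectI conjI perm)
    qed
    then show "(\<lambda>p. p \<circ> Transposition.transpose x z) ` perms_into A (insert x S) T \<subseteq> perms_into A (insert z S) T"
      by (rule image_subsetI)
  qed (auto simp: comp_assoc)
  have "(\<Sum>z\<in>A - S. card (perms_into A (insert z S) T))
      = (\<Sum>z\<in>A - S. \<Sum>p\<in>{p \<in> perms_into A S T. p z \<in> T}. 1)"
  proof (rule sum.cong[OF refl])
    fix z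
    have "perms_into A (insert z S) T = {p \<in> perms_into A S T. p z \<in> T}"
      by (auto simp: perms_into_def)
    then show "card (perms_into A (insert z S) T) = (\<Sum>p\<in>{p \<in> perms_into A S T. p z \<in> T}. 1)" by simp
  qed
  also have "\<dots> = (\<Sum>p\<in>perms_into A S T. \<Sum>z\<in>{z \<in> A - S. p z \<in> T}. 1)"
    by (rule sum.swap_restrict) (use A finite_perms_into in simp_all)
  also have "\<dots> = (\<Sum>p\<in>perms_into A S T. card T - card S)"
  proof (intro sum.cong refl)
    fix p assume "p \<in> perms_into A S T"
    then have p: "p permutes A" "p ` S \<subseteq> T" by (auto simp: perms_into_def)
    have inj: "inj p" using p permutes_inj by auto
    have "p ` {z \<in> A - S. p z \<in> T} = T - p ` S"
    proof (intro equalityI subsetI)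
      fix y assume "y \<in> T - p ` S"
      then have "y \<in> p ` A" using A permutes_image[OF p(1)] by auto
      then show "y \<in> p ` {z \<in> A - S. p z \<in> T}" using \<open>y \<in> T - p ` S\<close> by auto
    next
      fix y assume "y \<in> p ` {z \<in> A - S. p z \<in> T}"
      then obtain z where z: "y = p z" "z \<notin> S" "p z \<in> T" by auto
      then show "y \<in> T - p ` S" by (simp add: inj_image_mem_iff[OF inj])
    qed
    then have "card {z \<in> A - S. p z \<in> T} = card (T - p ` S)"
      using card_image[OF inj_on_subset[OF inj subset_UNIV], of "{z \<in> A - S. p z \<in> T}"] by simp
    also have "\<dots> = card T - card S"
      using p fin inj by (subst card_Diff_subset) (auto simp: card_image[OF inj_on_subset[OF inj subset_UNIV]])
    finally show "(\<Sum>z\<in>{z \<in> A - S. p z \<in> T}. 1) = card T - card S" by simp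
  qed
  finally have "(\<Sum>z\<in>A - S. card (perms_into A (insert z S) T))
      = (card T - card S) * card (perms_into A S T)" by (simp add: mult.commute)
  moreover have "(\<Sum>z\<in>A - S. card (perms_into A (insert z S) T))
      = (card A - card S) * card (perms_into A (insert x S) T)"
  proof -
    have "(\<Sum>z\<in>A - S. card (perms_into A (insert z S) T)) = (\<Sum>z\<in>A - S. card (perms_into A (insert x S) T))"
      by (rule sum.cong[OF refl inv])
    then show ?thesis using A fin by (simp add: card_Diff_subset)
  qed
  ultimately show ?thesis by simp
qed

text \<open>With \<open>s\<close> points placed, the next one lands in \<open>T\<close> with
  conditional probability (t - s) / (N - s), at most t / N because t \<le> N. A uniform permutation
  thus does no worse than independent choices.\<close>

lemma card_perms_into_le:
  assumes A: "finite A" "T \<subseteq> A"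
  shows "S \<subseteq> A \<Longrightarrow> card S \<le> card T \<Longrightarrow>
    real (card (perms_into A S T)) * real (card A) ^ card S \<le> fact (card A) * real (card T) ^ card S"
proof -
  assume S: "S \<subseteq> A" "card S \<le> card T"
  then have "finite S" using A finite_subset by auto
  then show ?thesis using S
  proof (induction S)
    case empty
    have "card (perms_into A {} T) = fact (card A)"
      using card_permutations[OF refl A(1)] by (simp add: perms_into_def)
    then show ?case by simp
  next
    case (insert x S)
    let ?N = "real (card A)" and ?t = "real (card T)" and ?s = "real (card S)"
    have st: "card S < card T" using insert by simp
    have tN: "card T \<le> card A" using A by (intro card_mono) auto
    have "real ((card A - card S) * card (perms_into A (insert x S) T))
        = real ((card T - card S) * card (perms_into A S T))"
      using card_perms_into_insert[of A S T x] A insert by simp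
    then have eq: "(?N - ?s) * real (card (perms_into A (insert x S) T)) = (?t - ?s) * real (card (perms_into A S T))"
      using st tN by (simp add: of_nat_diff)
    have le: "(?t - ?s) * ?N \<le> ?t * (?N - ?s)"
      using st tN mult_left_mono[of ?t ?N ?s] by (simp add: algebra_simps)
    have "(?N - ?s) * (real (card (perms_into A (insert x S) T)) * ?N) = ((?t - ?s) * ?N) * real (card (perms_into A S T))"
      using eq by (simp add: mult_ac)
    also have "\<dots> \<le> (?t * (?N - ?s)) * real (card (perms_into A S T))"
      using le by (intro mult_right_mono) auto
    finally have "(?N - ?s) * (real (card (perms_into A (insert x S) T)) * ?N) \<le> (?N - ?s) * (?t * real (card (perms_into A S T)))"
      by (simp add: mult_ac)
    then have "real (card (perms_into A (insert x S) T)) * ?N \<le> ?t * real (card (perms_into A S T))"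
      using st tN by (simp add: mult_le_cancel_left)
    then have "real (card (perms_into A (insert x S) T)) * ?N * ?N ^ card S \<le> ?t * real (card (perms_into A S T)) * ?N ^ card S"
      by (intro mult_right_mono) auto
    also have "\<dots> = ?t * (real (card (perms_into A S T)) * ?N ^ card S)" by simp
    also have "\<dots> \<le> ?t * (fact (card A) * ?t ^ card S)"
      using insert by (intro mult_left_mono insert.IH) auto
    finally show ?case using insert by (simp add: mult_ac)
  qed
qed

text \<open>Union bound over sets \<open>S\<close> of size s and \<open>T\<close> of size 2s. There
  are at most N^(3s) such pairs, and eight independent permutations all send \<open>S\<close> into
  \<open>T\<close> with probability at most (2s/N)^(8s) \<le> N^(-4s), because (2s)^2 \<le> N. Each
  s \<ge> 1 contributes at most 1/N, and fewer than N values of s occur.\<close>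

lemma expanding_permutations_exist:
  assumes A: "finite A"
  shows "\<exists>p :: nat \<Rightarrow> 'a \<Rightarrow> 'a. (\<forall>m. p m permutes A) \<and>
    (\<forall>S\<subseteq>A. 4 * (card S)\<^sup>2 \<le> card A \<longrightarrow> 2 * card S \<le> card (\<Union>m<8. p m ` S))"
proof -
  have binomial_le_pow_all: "n choose k \<le> n ^ k" for n k :: nat
    by (cases "k \<le> n") (auto simp: binomial_le_pow binomial_eq_0)
  define N where "N = card A"
  define \<Omega> where "\<Omega> = PiE {..<8::nat} (\<lambda>_. {p. p permutes A})"
  define bad where "bad S T = PiE {..<8::nat} (\<lambda>_. perms_into A S T)" for S T
  define I where "I s = {(S, T). S \<subseteq> A \<and> T \<subseteq> A \<and> card S = s \<and> card T = 2 * s}" for s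
  define R where "R = {s. 1 \<le> s \<and> 4 * s\<^sup>2 \<le> N}"
  have finI: "finite (I s)" for s
    by (rule finite_subset[of _ "Pow A \<times> Pow A"]) (auto simp: I_def A)
  have R_sub: "R \<subseteq> {1..<N}"
  proof
    fix s assume s: "s \<in> R"
    then have "1 \<le> s" "4 * s\<^sup>2 \<le> N" by (auto simp: R_def)
    moreover have "s < 4 * s\<^sup>2" using \<open>1 \<le> s\<close> by (simp add: power2_eq_square)
    ultimately show "s \<in> {1..<N}" by auto
  qed
  then have finR: "finite R" using finite_subset by blast
  have fin\<Omega>: "finite \<Omega>" unfolding \<Omega>_def using A finite_permutations by (intro finite_PiE) auto
  have card\<Omega>: "real (card \<Omega>) = fact N ^ 8"
    by (simp add: \<Omega>_def card_PiE card_permutations[OF refl A] N_def)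
  have cardI: "real (card (I s)) \<le> real N ^ (3 * s)" for s
  proof -
    have "I s = {S. S \<subseteq> A \<and> card S = s} \<times> {T. T \<subseteq> A \<and> card T = 2 * s}" by (auto simp: I_def)
    then have "card (I s) = (N choose s) * (N choose (2 * s))"
      using A by (simp add: card_cartesian_product n_subsets N_def)
    also have "\<dots> \<le> N ^ s * N ^ (2 * s)"
      by (intro mult_mono) (auto intro: binomial_le_pow_all)
    finally show ?thesis by (simp add: power_add[symmetric] of_nat_power[symmetric] del: of_nat_power)
  qed
  have card_bad: "real (card (bad S T)) * real N ^ (4 * s) \<le> fact N ^ 8" if s: "s \<in> R" and ST: "(S, T) \<in> I s" for s S T
  proof -
    have ST: "S \<subseteq> A" "T \<subseteq> A" "card S = s" "card T = 2 * s" using ST by (auto simp: I_def)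
    have N0: "0 < real N" using s R_sub by force
    let ?c = "real (card (perms_into A S T))"
    have "?c * real N ^ s \<le> fact N * (2 * real s) ^ s"
      using card_perms_into_le[OF A ST(2,1)] ST by (simp add: N_def)
    then have "(?c * real N ^ s) ^ 8 \<le> (fact N * (2 * real s) ^ s) ^ 8"
      by (intro power_mono) auto
    also have "\<dots> = fact N ^ 8 * (((2 * real s)\<^sup>2) ^ 4) ^ s"
      unfolding power_mult_distrib[of "fact N"] power_mult[symmetric] by (simp add: mult.commute)
    also have "\<dots> \<le> fact N ^ 8 * (real N ^ 4) ^ s"
    proof -
      have "real (4 * s\<^sup>2) \<le> real N" using s unfolding R_def by (intro of_nat_mono) auto
      then have "(2 * real s)\<^sup>2 \<le> real N" by (simp add: power2_eq_square)
      then show ?thesis by (intro mult_left_mono power_mono) auto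
    qed
    finally have le: "(?c * real N ^ s) ^ 8 \<le> fact N ^ 8 * (real N ^ 4) ^ s" .
    have "(?c ^ 8 * real N ^ (4 * s)) * real N ^ (4 * s) \<le> fact N ^ 8 * real N ^ (4 * s)"
    proof -
      have "(real N ^ s) ^ 8 = real N ^ (4 * s) * real N ^ (4 * s)" "(real N ^ 4) ^ s = real N ^ (4 * s)"
        by (simp_all add: power_mult[symmetric] power_add[symmetric] mult.commute)
      then show ?thesis using le
        by (simp only: power_mult_distrib[of ?c] mult.assoc[symmetric])
    qed
    then have "?c ^ 8 * real N ^ (4 * s) \<le> fact N ^ 8" using N0 by simp
    then show ?thesis by (simp add: bad_def card_PiE)
  qed
  have "\<not> \<Omega> \<subseteq> (\<Union>s\<in>R. \<Union>(S, T)\<in>I s. bad S T)"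
  proof
    assume sub: "\<Omega> \<subseteq> (\<Union>s\<in>R. \<Union>(S, T)\<in>I s. bad S T)"
    have finbad: "finite (bad S T)" for S T
      using A finite_perms_into by (auto simp: bad_def intro!: finite_PiE)
    have "card \<Omega> \<le> card (\<Union>s\<in>R. \<Union>(S, T)\<in>I s. bad S T)"
      using finR finI finbad sub by (intro card_mono) auto
    also have "\<dots> \<le> (\<Sum>s\<in>R. card (\<Union>(S, T)\<in>I s. bad S T))" by (rule card_UN_le[OF finR])
    also have "\<dots> \<le> (\<Sum>s\<in>R. \<Sum>(S, T)\<in>I s. card (bad S T))"
      using card_UN_le[OF finI] by (intro sum_mono) (simp add: case_prod_unfold)
    finally have "real (card \<Omega>) \<le> (\<Sum>s\<in>R. \<Sum>(S, T)\<in>I s. real (card (bad S T)))"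
      by (simp add: case_prod_unfold of_nat_sum[symmetric] del: of_nat_sum)
    also have "\<dots> \<le> (\<Sum>s\<in>R. fact N ^ 8 / real N)"
    proof (intro sum_mono)
      fix s assume s: "s \<in> R"
      have N0: "1 \<le> real N" using s R_sub by force
      have "(\<Sum>(S, T)\<in>I s. real (card (bad S T))) \<le> (\<Sum>(S, T)\<in>I s. fact N ^ 8 / real N ^ (4 * s))"
        using card_bad[OF s] N0 by (intro sum_mono) (auto simp: pos_le_divide_eq)
      also have "\<dots> = real (card (I s)) * (fact N ^ 8 / real N ^ (4 * s))" by simp
      also have "\<dots> \<le> real N ^ (3 * s) * (fact N ^ 8 / real N ^ (4 * s))"
        by (intro mult_right_mono cardI) auto
      also have "\<dots> = fact N ^ 8 / real N ^ s"
      proof -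
        have "real N ^ (4 * s) = real N ^ (3 * s) * real N ^ s" by (simp add: power_add[symmetric])
        then show ?thesis using N0 by simp
      qed
      also have "\<dots> \<le> fact N ^ 8 / real N"
        using N0 s power_increasing[of 1 s "real N"] by (intro divide_left_mono) (auto simp: R_def)
      finally show "(\<Sum>(S, T)\<in>I s. real (card (bad S T))) \<le> fact N ^ 8 / real N" .
    qed
    also have "\<dots> = real (card R) / real N * fact N ^ 8" by simp
    finally have "fact N ^ 8 \<le> real (card R) / real N * fact N ^ 8" by (simp add: card\<Omega>)
    moreover have "(0::real) < fact N ^ 8" by simp
    ultimately have ge: "1 \<le> real (card R) / real N"
      by (metis mult_1 mult_le_cancel_right_pos)
    then have "0 < N" by (cases "N = 0") auto
    moreover have "card R \<le> N - 1" using card_mono[OF _ R_sub] by simp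
    ultimately have "card R < N" by linarith
    then show False using ge by (simp add: field_simps)
  qed
  then obtain q where q: "q \<in> \<Omega>" "q \<notin> (\<Union>s\<in>R. \<Union>(S, T)\<in>I s. bad S T)" by blast
  \<comment> \<open>Elements of \<open>\<Omega>\<close> are extensional on the indices below 8; the
    identity beyond makes every \<open>p m\<close> a permutation of \<open>A\<close>.\<close>
  define p where "p m = (if m < 8 then q m else id)" for m :: nat
  have perm: "p m permutes A" for m
    using q by (auto simp: p_def \<Omega>_def PiE_iff permutes_id)
  have "2 * card S \<le> card (\<Union>m<8. p m ` S)" if S: "S \<subseteq> A" "4 * (card S)\<^sup>2 \<le> card A" for S
  proof (rule ccontr)
    assume "\<not> 2 * card S \<le> card (\<Union>m<8. p m ` S)"
    then have lt: "card (\<Union>m<8. p m ` S) < 2 * card S" by simp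
    then have s1: "1 \<le> card S" by simp
    have UA: "(\<Union>m<8. p m ` S) \<subseteq> A" using perm S permutes_image by blast
    \<comment> \<open>This leaves room in \<open>A\<close> to enlarge the too small union to a set
      \<open>T\<close> of exactly \<open>2 * card S\<close> points, the only size of target in the
      union bound.\<close>
    have "2 * card S \<le> 4 * (card S)\<^sup>2" using s1 by (simp add: power2_eq_square)
    then have "2 * card S \<le> card A" using S by linarith
    then obtain T where T: "(\<Union>m<8. p m ` S) \<subseteq> T" "T \<subseteq> A" "card T = 2 * card S"
      using exists_subset_between[of "\<Union>m<8. p m ` S" "2 * card S" A] lt UA A by auto
    have "q i ` S \<subseteq> T" if "i < 8" for i
      using T(1) that by (fastforce simp: p_def)
    then have "q \<in> bad S T"
      using q(1) by (auto simp: bad_def \<Omega>_def PiE_iff perms_into_def)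
    moreover have "card S \<in> R" "(S, T) \<in> I (card S)" using S s1 T by (auto simp: R_def I_def N_def)
    ultimately show False using q by blast
  qed
  then show ?thesis using perm by blast
qed

section \<open>The layered tree\<close>

text \<open>A vertex will be a bit string, its place in the binary tree, together with a height in
  the fibre over it. \<open>K j\<close> is the fibre length over level \<open>j\<close>. Each
  \<open>p m\<close> is one map on all bit strings which, being injective and length preserving,
  permutes every level.\<close>

locale layered_tree =
  fixes K :: "nat \<Rightarrow> nat" and p :: "nat \<Rightarrow> bool list \<Rightarrow> bool list"
  assumes K_mono: "mono K" and K_pos: "1 \<le> K j"
    and p_inj: "inj (p m)" and p_length: "length (p m xs) = length xs"
    and p_expand: "S \<subseteq> {xs. length xs = j} \<Longrightarrow> 4 * (card S)\<^sup>2 \<le> 2 ^ j \<Longrightarrow>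
      2 * card S \<le> card (\<Union>m<8. p m ` S)"
begin

text \<open>The disjuncts are the fibre arcs, the tree arcs and the permutation arcs. The condition
  \<open>fst u \<noteq> fst v\<close> excludes loops at fixed points of the permutations.\<close>

definition adj :: "bool list \<times> nat \<Rightarrow> bool list \<times> nat \<Rightarrow> bool" where
  "adj u v \<longleftrightarrow>
    (fst u = fst v \<and> (snd v = Suc (snd u) \<or> snd u = Suc (snd v))) \<or>
    (snd u = 0 \<and> snd v = 0 \<and> (\<exists>c. fst v = c # fst u \<or> fst u = c # fst v)) \<or>
    (snd u = snd v \<and> fst u \<noteq> fst v \<and> (\<exists>m<8. fst v = p m (fst u) \<or> fst u = p m (fst v)))"

definition V :: "(bool list \<times> nat) set" where "V = {u. snd u \<le> K (length (fst u))}"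

definition T :: "(bool list \<times> nat) pair_pre_digraph" where
  "T = \<lparr>pverts = V, parcs = {(u, v). u \<in> V \<and> v \<in> V \<and> adj u v}\<rparr>"

lemma T_simps: "pverts T = V" "(u, v) \<in> parcs T \<longleftrightarrow> u \<in> V \<and> v \<in> V \<and> adj u v"
  by (auto simp: T_def)

lemma adj_sym: "adj u v \<longleftrightarrow> adj v u"
  unfolding adj_def by metis

lemma adj_irrefl: "\<not> adj u u"
  by (auto simp: adj_def)

text \<open>The list may contain points that are not neighbours; it serves the count 5 + 8 + 8 = 21.
  Injectivity of \<open>p m\<close> leaves a single candidate for each arc coming in along
  \<open>p m\<close>.\<close>

lemma neighbours_subset:
  "neighbours T (xs, i) \<subseteq> {(xs, Suc i), (xs, i - 1), (True # xs, 0), (False # xs, 0), (tl xs, 0)}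
     \<union> (\<lambda>m. (p m xs, i)) ` {..<8} \<union> (\<lambda>m. (inv (p m) xs, i)) ` {..<8}"
proof
  fix v assume "v \<in> neighbours T (xs, i)"
  then obtain ys k where v: "v = (ys, k)" and a: "adj (xs, i) (ys, k)"
    by (cases v) (auto simp: neighbours_def T_simps)
  have inv_p: "inv (p m) (p m ys) = ys" for m by (rule inv_f_f[OF p_inj])
  show "v \<in> {(xs, Suc i), (xs, i - 1), (True # xs, 0), (False # xs, 0), (tl xs, 0)}
     \<union> (\<lambda>m. (p m xs, i)) ` {..<8} \<union> (\<lambda>m. (inv (p m) xs, i)) ` {..<8}"
    using a[unfolded adj_def]
  proof (elim disjE)
    assume "snd (xs, i) = snd (ys, k) \<and> fst (xs, i) \<noteq> fst (ys, k) \<and>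
      (\<exists>m<8. fst (ys, k) = p m (fst (xs, i)) \<or> fst (xs, i) = p m (fst (ys, k)))"
    then obtain m where "k = i" "m < 8" "ys = p m xs \<or> ys = inv (p m) xs"
      using inv_p by auto
    then show ?thesis by (auto simp: v)
  next
    assume "snd (xs, i) = 0 \<and> snd (ys, k) = 0 \<and>
      (\<exists>c. fst (ys, k) = c # fst (xs, i) \<or> fst (xs, i) = c # fst (ys, k))"
    then obtain c where "i = 0" "k = 0" "ys = c # xs \<or> xs = c # ys" by auto
    then show ?thesis by (cases c) (auto simp: v)
  qed (auto simp: v)
qed

lemma card_neighbours: "finite (neighbours T u)" "card (neighbours T u) \<le> 21"
proof -
  obtain xs i where u: "u = (xs, i)" by (cases u)
  let ?A = "{(xs, Suc i), (xs, i - 1), (True # xs, 0), (False # xs, 0), (tl xs, 0)}"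
  let ?B = "(\<lambda>m. (p m xs, i)) ` {..<8::nat}" and ?C = "(\<lambda>m. (inv (p m) xs, i)) ` {..<8::nat}"
  show "finite (neighbours T u)" unfolding u by (rule finite_subset[OF neighbours_subset]) auto
  have "card ?A \<le> 5" using card_length[of "[(xs, Suc i), (xs, i - 1), (True # xs, 0), (False # xs, 0), (tl xs, 0)]"] by simp
  moreover have "card ?B \<le> 8" "card ?C \<le> 8"
    using card_image_le[of "{..<8::nat}"] by (metis card_lessThan finite_lessThan)+
  moreover have "card (neighbours T u) \<le> card (?A \<union> ?B \<union> ?C)"
    unfolding u by (rule card_mono[OF _ neighbours_subset]) auto
  moreover have "card (?A \<union> ?B \<union> ?C) \<le> card ?A + card ?B + card ?C"
    by (meson add_le_mono1 card_Un_le order_trans)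
  ultimately show "card (neighbours T u) \<le> 21" by linarith
qed

lemma bidirected_T: "pair_bidirected_digraph T"
proof
  show "symmetric (with_proj T)"
    using adj_sym by (auto simp: symmetric_def sym_def T_simps)
qed (auto simp: T_def adj_irrefl)

sublocale bounded_graph T 21
  by (rule bounded_graph.intro[OF bidirected_T]) (auto simp: card_neighbours valency_def)

lemma card_level: "card {xs :: bool list. length xs = j} = 2 ^ j"
  using card_lists_length_eq[of "UNIV :: bool set" j] by simp

lemma finite_level: "finite {xs :: bool list. length xs = j}"
  using finite_lists_length_eq[of "UNIV :: bool set" j] by simp

section \<open>Isoperimetric inequality in the layered tree\<close>

lemma finite_boundary: "finite U \<Longrightarrow> finite (edge_boundary T U)"
  by (rule finite_subset[OF _ finite_arcs_at[of U]]) (auto simp: edge_boundary_def arcs_at_def)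

lemma boundaryI: "U \<subseteq> V \<Longrightarrow> u \<in> U \<Longrightarrow> v \<in> V \<Longrightarrow> v \<notin> U \<Longrightarrow> adj u v \<Longrightarrow> (u, v) \<in> edge_boundary T U"
  by (auto simp: edge_boundary_def T_simps)

text \<open>Slice \<open>U\<close> by level and height. A slice at a level from \<open>J\<close> on
  has at most \<open>card U\<close> points, few enough for the expansion there, so its permutation
  arcs reach at least as many points outside \<open>U\<close> at the same level and height.\<close>

lemma high_part:
  assumes U: "finite U" "U \<subseteq> V" and J: "4 * (card U)\<^sup>2 \<le> 2 ^ J"
  shows "card {u \<in> U. J \<le> length (fst u)} \<le> card (edge_boundary T U)"
proof -
  define S where "S q = {xs. length xs = fst q \<and> (xs, snd q) \<in> U}" for q :: "nat \<times> nat"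
  define Y where "Y q = (\<Union>m<8. p m ` S q) - S q" for q
  define I where "I = (\<lambda>u. (length (fst u), snd u)) ` {u \<in> U. J \<le> length (fst u)}"
  have finI: "finite I" using U by (simp add: I_def)
  have S_sub: "(\<lambda>xs. (xs, snd q)) ` S q \<subseteq> U" for q by (auto simp: S_def)
  have finS: "finite (S q)" for q
    using finite_subset[OF _ finite_level[of "fst q"]] by (auto simp: S_def)
  have finY: "finite (Y q)" for q using finS by (auto simp: Y_def)
  have Y_len: "length ys = fst q" if "ys \<in> Y q" for ys q
    using that by (auto simp: Y_def S_def p_length)
  have SY: "card (S q) \<le> card (Y q)" if "q \<in> I" for q
  proof -
    have "card (S q) = card ((\<lambda>xs. (xs, snd q)) ` S q)" by (simp add: card_image inj_on_def)
    also have "\<dots> \<le> card U" by (rule card_mono[OF U(1) S_sub])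
    finally have "4 * (card (S q))\<^sup>2 \<le> 4 * (card U)\<^sup>2" by (simp add: power_mono)
    also have "\<dots> \<le> 2 ^ fst q"
    proof -
      have "J \<le> fst q" using that by (auto simp: I_def)
      then have "(2::nat) ^ J \<le> 2 ^ fst q" by (intro power_increasing) auto
      then show ?thesis using J by linarith
    qed
    finally have "2 * card (S q) \<le> card (\<Union>m<8. p m ` S q)"
      by (intro p_expand[of _ "fst q"]) (auto simp: S_def)
    then show ?thesis
      using diff_card_le_card_Diff[OF finS[of q], of "\<Union>m<8. p m ` S q"] by (simp add: Y_def)
  qed
  have "{u \<in> U. J \<le> length (fst u)} \<subseteq> (\<Union>q\<in>I. S q \<times> {snd q})"
    by (force simp: I_def S_def)
  then have "card {u \<in> U. J \<le> length (fst u)} \<le> card (\<Union>q\<in>I. S q \<times> {snd q})"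
    using finI finS by (intro card_mono) auto
  also have "\<dots> \<le> (\<Sum>q\<in>I. card (S q \<times> {snd q}))" by (rule card_UN_le[OF finI])
  also have "\<dots> \<le> (\<Sum>q\<in>I. card (Y q \<times> {snd q}))"
    using SY by (intro sum_mono) (simp add: card_cartesian_product)
  \<comment> \<open>Points reached from different slices differ in level or height, so the sum
    counts distinct points, each the endpoint of a boundary arc.\<close>
  also have "\<dots> = card (\<Union>q\<in>I. Y q \<times> {snd q})"
  proof (rule card_UN_disjoint[symmetric])
    show "\<forall>q\<in>I. \<forall>q'\<in>I. q \<noteq> q' \<longrightarrow> Y q \<times> {snd q} \<inter> Y q' \<times> {snd q'} = {}"
    proof (intro ballI impI)
      fix q q' :: "nat \<times> nat" assume "q \<noteq> q'"
      then have "\<not> (ys \<in> Y q \<and> ys \<in> Y q' \<and> snd q = snd q')" for ys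
        using Y_len[of ys q] Y_len[of ys q'] by (metis prod_eqI)
      then show "Y q \<times> {snd q} \<inter> Y q' \<times> {snd q'} = {}" by auto
    qed
  qed (use finI finY in auto)
  also have "\<dots> \<le> card (snd ` edge_boundary T U)"
  proof (intro card_mono finite_imageI finite_boundary U subsetI)
    fix v assume "v \<in> (\<Union>q\<in>I. Y q \<times> {snd q})"
    then obtain q ys where q: "v = (ys, snd q)" "ys \<in> Y q" by auto
    then obtain m xs where m: "m < 8" "xs \<in> S q" "ys = p m xs" "ys \<notin> S q" by (auto simp: Y_def)
    have "((xs, snd q), v) \<in> edge_boundary T U"
      using m U q(1) by (intro boundaryI) (auto simp: S_def V_def p_length adj_def)
    then show "v \<in> snd ` edge_boundary T U" by force
  qed
  also have "\<dots> \<le> card (edge_boundary T U)" by (intro card_image_le finite_boundary U)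
  finally show ?thesis .
qed

text \<open>At least half of the downward tree arcs from the base points of \<open>U\<close> leave \<open>U\<close>, and a fibre that meets
  \<open>U\<close> but has its base point outside \<open>U\<close> contains a vertical boundary arc.\<close>

lemma low_part:
  assumes U: "finite U" "U \<subseteq> V"
  shows "card {u \<in> U. length (fst u) < J} \<le> (K J + 1) * card (edge_boundary T U)"
proof -
  define W where "W = {xs. (xs, 0) \<in> U}"
  define F where "F = fst ` {u \<in> U. length (fst u) < J}"
  define X where "X = {(xs, c). xs \<in> W \<and> c # xs \<notin> W}"
  define down where "down = (\<lambda>(xs :: bool list, c). ((xs, 0::nat), (c # xs, 0::nat)))"
  define vert where "vert = {e \<in> edge_boundary T U. fst (fst e) = fst (snd e)}"
  have finW: "finite W"
    using finite_subset[of W "fst ` U"] U by (force simp: W_def)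
  have finF: "finite F" using U by (simp add: F_def)
  have X_sub: "X \<subseteq> W \<times> UNIV" by (auto simp: X_def)
  have finX: "finite X" by (rule finite_subset[OF X_sub]) (simp add: finW)
  have finb: "finite (edge_boundary T U)" using U by (rule_tac finite_boundary)
  \<comment> \<open>Every point has two children and distinct pairs give distinct children, so of
    the \<open>2 * card W\<close> children at most \<open>card W\<close> belong to
    \<open>W\<close>.\<close>
  have "card (W \<times> (UNIV :: bool set)) \<le> card X + card W"
  proof -
    have "(\<lambda>(xs, c). c # xs) ` (W \<times> UNIV - X) \<subseteq> W" by (auto simp: X_def)
    then have "card (W \<times> (UNIV :: bool set) - X) \<le> card W"
      by (intro card_inj_on_le[OF _ _ finW, of "\<lambda>(xs, c). c # xs"]) (auto simp: inj_on_def)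
    then show ?thesis using card_Diff_subset[OF finX X_sub] card_mono[OF _ X_sub] finW by auto
  qed
  then have WX: "card W \<le> card X" by (simp add: card_cartesian_product)
  have down_sub: "down ` X \<subseteq> edge_boundary T U"
    using U by (auto simp: down_def X_def W_def V_def intro!: boundaryI) (auto simp: adj_def)
  have down_card: "card (down ` X) = card X"
    by (intro card_image) (auto simp: inj_on_def down_def)
  have "F - W \<subseteq> (\<lambda>e. fst (fst e)) ` vert"
  proof
    fix xs assume xs: "xs \<in> F - W"
    then obtain i where i: "(xs, i) \<in> U" by (auto simp: F_def)
    \<comment> \<open>The lowest point of \<open>U\<close> in this fibre is not the base point, so
      the fibre arc below it leaves \<open>U\<close>.\<close>
    define a where "a = (LEAST i. (xs, i) \<in> U)"
    have a: "(xs, a) \<in> U" unfolding a_def using i by (rule LeastI)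
    then obtain b where b: "a = Suc b" using xs by (cases a) (auto simp: W_def)
    have nb: "(xs, b) \<notin> U" using not_less_Least[of b "\<lambda>i. (xs, i) \<in> U"] b by (auto simp: a_def)
    have "((xs, a), (xs, b)) \<in> edge_boundary T U"
      using U a b nb by (intro boundaryI) (auto simp: V_def adj_def)
    then have "((xs, a), (xs, b)) \<in> vert" by (simp add: vert_def)
    then show "xs \<in> (\<lambda>e. fst (fst e)) ` vert" by force
  qed
  then have "card (F - W) \<le> card vert"
    using finb by (intro surj_card_le) (auto simp: vert_def)
  moreover have "card F \<le> card W + card (F - W)"
  proof -
    have "card F \<le> card (W \<union> (F - W))" using finW finF by (intro card_mono) auto
    also have "\<dots> \<le> card W + card (F - W)" by (rule card_Un_le)
    finally show ?thesis .
  qed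
  \<comment> \<open>Tree arcs change the bit string and fibre arcs keep it, so no boundary arc is
    counted twice.\<close>
  moreover have "card (down ` X) + card vert \<le> card (edge_boundary T U)"
  proof -
    have "card (down ` X) + card vert = card (down ` X \<union> vert)"
      using finX finb by (intro card_Un_disjoint[symmetric]) (auto simp: vert_def down_def)
    also have "\<dots> \<le> card (edge_boundary T U)"
      using down_sub finb by (intro card_mono) (auto simp: vert_def)
    finally show ?thesis .
  qed
  ultimately have FB: "card F \<le> card (edge_boundary T U)" using WX down_card by linarith
  have "{u \<in> U. length (fst u) < J} \<subseteq> F \<times> {..K J}"
  proof
    fix u assume u: "u \<in> {u \<in> U. length (fst u) < J}"
    then have "snd u \<le> K (length (fst u))" using U by (auto simp: V_def)
    also have "\<dots> \<le> K J" using u by (intro monoD[OF K_mono]) auto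
    finally show "u \<in> F \<times> {..K J}" using u by (cases u) (force simp: F_def)
  qed
  then have "card {u \<in> U. length (fst u) < J} \<le> card (F \<times> {..K J})"
    using finF by (intro card_mono) auto
  also have "\<dots> = (K J + 1) * card F" by (simp add: card_cartesian_product mult.commute)
  also have "\<dots> \<le> (K J + 1) * card (edge_boundary T U)" using FB by (rule mult_le_mono2)
  finally show ?thesis .
qed

lemma isoperimetry:
  assumes U: "finite U" "U \<subseteq> V" and J: "4 * (card U)\<^sup>2 \<le> 2 ^ J"
  shows "card U \<le> (K J + 2) * card (edge_boundary T U)"
proof -
  have "{u \<in> U. J \<le> length (fst u)} \<union> {u \<in> U. length (fst u) < J} = U" by auto
  then have "card U \<le> card {u \<in> U. J \<le> length (fst u)} + card {u \<in> U. length (fst u) < J}"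
    using card_Un_le[of "{u \<in> U. J \<le> length (fst u)}" "{u \<in> U. length (fst u) < J}"] by simp
  then show ?thesis using high_part[OF assms] low_part[OF U, of J] by simp
qed

section \<open>The fibres over one level and the sine wave along them\<close>

definition block :: "nat \<Rightarrow> (bool list \<times> nat) set" where
  "block j = {xs. length xs = j} \<times> {..K j}"

lemma block_V: "block j \<subseteq> V"
  by (auto simp: block_def V_def)

lemma finite_block: "finite (block j)"
  by (simp add: block_def finite_level)

lemma card_block: "card (block j) = 2 ^ j * (K j + 1)"
  by (simp add: block_def card_cartesian_product card_level)

text \<open>Fibre arcs stay in the block and permutation arcs preserve level and height, so only
  tree arcs leave; each of the \<open>2 ^ j\<close> base points has two children and at most one
  parent.\<close>

lemma card_boundary_block: "card (edge_boundary T (block j)) \<le> 3 * 2 ^ j"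
proof -
  define L where "L = {xs :: bool list. length xs = j}"
  define e where "e ys xs = ((xs :: bool list, 0::nat), (ys :: bool list, 0::nat))" for ys xs
  have "edge_boundary T (block j) \<subseteq> (\<lambda>xs. e (True # xs) xs) ` L \<union> (\<lambda>xs. e (False # xs) xs) ` L \<union> (\<lambda>xs. e (tl xs) xs) ` L"
  proof
    fix b assume b: "b \<in> edge_boundary T (block j)"
    then obtain xs i ys k where b_eq: "b = ((xs, i), (ys, k))" by (metis prod.exhaust)
    have *: "xs \<in> L" "\<not> (length ys = j \<and> k \<le> K j)" "k \<le> K (length ys)" "i \<le> K j" "adj (xs, i) (ys, k)"
      using b by (auto simp: b_eq edge_boundary_def T_simps block_def V_def L_def)
    have "i = 0 \<and> k = 0 \<and> (\<exists>c. ys = c # xs \<or> xs = c # ys)"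
      using *(5) *(1-4) by (auto simp: adj_def L_def p_length)
    then obtain c where "i = 0" "k = 0" "ys = c # xs \<or> ys = tl xs" by auto
    then show "b \<in> (\<lambda>xs. e (True # xs) xs) ` L \<union> (\<lambda>xs. e (False # xs) xs) ` L \<union> (\<lambda>xs. e (tl xs) xs) ` L"
      using *(1) by (cases c) (auto simp: b_eq e_def)
  qed
  moreover have fL: "finite L" using finite_level by (simp add: L_def)
  ultimately have "card (edge_boundary T (block j)) \<le> card ((\<lambda>xs. e (True # xs) xs) ` L \<union> (\<lambda>xs. e (False # xs) xs) ` L \<union> (\<lambda>xs. e (tl xs) xs) ` L)"
    by (intro card_mono) auto
  also have "\<dots> \<le> card ((\<lambda>xs. e (True # xs) xs) ` L) + card ((\<lambda>xs. e (False # xs) xs) ` L) + card ((\<lambda>xs. e (tl xs) xs) ` L)"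
    by (meson add_le_mono1 card_Un_le order_trans)
  also have "\<dots> \<le> card L + card L + card L" by (intro add_mono card_image_le fL)
  finally show ?thesis using card_level[of j] by (simp add: L_def)
qed

text \<open>A quarter period of the sine: zero at the base, where the tree arcs leave the block, and
  maximal at the far end of the fibre, which acts as a reflecting boundary.\<close>

definition wave :: "nat \<Rightarrow> bool list \<times> nat \<Rightarrow> real" where
  "wave j u = (if u \<in> block j then sin (pi / (2 * real (K j)) * snd u) else 0)"

lemma wave_bounds: "0 \<le> wave j u" "wave j u \<le> 1"
proof -
  have "0 \<le> sin (pi / (2 * real (K j)) * snd u)" if "u \<in> block j"
  proof (rule sin_ge_zero)
    have "real (snd u) \<le> K j" using that by (auto simp: block_def)
    then have "pi / (2 * real (K j)) * snd u \<le> pi / (2 * real (K j)) * K j" by (intro mult_left_mono) auto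
    also have "\<dots> \<le> pi" using K_pos[of j] by simp
    finally show "pi / (2 * real (K j)) * snd u \<le> pi" .
  qed auto
  then show "0 \<le> wave j u" by (simp add: wave_def)
qed (simp add: wave_def)

text \<open>At the base the wave vanishes. Above it, permutation neighbours carry the same value
  \<open>s\<close>, and the two fibre neighbours average to \<open>cos \<theta> * s\<close> by the
  addition theorem. At the far end \<open>s = 1\<close>, and the only fibre neighbour has the value
  \<open>cos \<theta>\<close>.\<close>

lemma wave_subharmonic: "cos (pi / (2 * real (K j))) * wave j u \<le> avg (wave j) u"
proof (cases "u \<in> block j \<and> snd u \<noteq> 0")
  case False
  then have "wave j u = 0" by (auto simp: wave_def)
  moreover have "0 \<le> avg (wave j) u"
    unfolding avg_def using wave_bounds mass_pos[of u] by (intro divide_nonneg_pos sum_nonneg) auto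
  ultimately show ?thesis by simp
next
  case True
  define \<theta> where "\<theta> = pi / (2 * real (K j))"
  obtain xs i where u: "u = (xs, Suc i)" using True by (cases u, cases "snd u") auto
  have len: "length xs = j" and iK: "Suc i \<le> K j" using True by (auto simp: u block_def)
  define s where "s = sin (\<theta> * Suc i)"
  have wu: "wave j u = s" using True by (simp add: wave_def u s_def \<theta>_def)
  have s0: "0 \<le> s" using wave_bounds(1)[of j u] wu by simp
  define Vt where "Vt = {v \<in> neighbours T u. fst v = xs}"
  define Hz where "Hz = neighbours T u - Vt"
  have fin: "finite Vt" "finite Hz" using card_neighbours by (auto simp: Vt_def Hz_def)
  have Hz_wave: "wave j v = s" if "v \<in> Hz" for v
  proof -
    have "v \<in> V" "adj u v" "fst v \<noteq> xs" using that by (auto simp: Hz_def Vt_def neighbours_def T_simps)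
    then have "snd v = Suc i" "length (fst v) = j" using len by (auto simp: adj_def u p_length)
    then show ?thesis using iK by (cases v) (auto simp: wave_def block_def s_def \<theta>_def)
  qed
  have \<theta>K: "\<theta> * K j = pi / 2" using K_pos[of j] by (simp add: \<theta>_def)
  have Vt_sum: "(\<Sum>v\<in>Vt. wave j v) = real (card Vt) * (cos \<theta> * s)"
  proof (cases "Suc i = K j")
    case True
    then have Vt: "Vt = {(xs, i)}" using len by (auto simp: Vt_def neighbours_def T_simps V_def u adj_def)
    have "real (K j) = real i + 1" using True by (metis of_nat_Suc add.commute)
    then have "\<theta> * real i = pi / 2 - \<theta>" using \<theta>K by (simp add: algebra_simps)
    moreover have "wave j (xs, i) = sin (\<theta> * real i)"
      using iK len by (simp add: wave_def block_def \<theta>_def)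
    ultimately have "wave j (xs, i) = sin (pi / 2 - \<theta>)" by simp
    also have "\<dots> = cos \<theta>" by (simp add: sin_diff)
    finally have "wave j (xs, i) = cos \<theta>" .
    moreover have "s = 1" unfolding s_def True \<theta>K by simp
    ultimately show ?thesis by (simp add: Vt)
  next
    case False
    then have Vt: "Vt = {(xs, i), (xs, Suc (Suc i))}"
      using len iK by (auto simp: Vt_def neighbours_def T_simps V_def u adj_def)
    have "wave j (xs, i) = sin (\<theta> * Suc i - \<theta>)" "wave j (xs, Suc (Suc i)) = sin (\<theta> * Suc i + \<theta>)"
    proof -
      have w: "wave j (xs, k) = sin (\<theta> * real k)" if "k \<le> K j" for k
        using that len by (simp add: wave_def block_def \<theta>_def)
      show "wave j (xs, i) = sin (\<theta> * Suc i - \<theta>)" "wave j (xs, Suc (Suc i)) = sin (\<theta> * Suc i + \<theta>)"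
        using iK False by (simp_all add: w algebra_simps)
    qed
    then show ?thesis by (simp add: Vt sin_diff sin_add s_def)
  qed
  have hood_eq: "hood u = insert u (Vt \<union> Hz)" by (auto simp: hood_def Vt_def Hz_def)
  have un: "u \<notin> Vt \<union> Hz" "Vt \<inter> Hz = {}"
    using adj_irrefl by (auto simp: Vt_def Hz_def neighbours_def T_simps)
  have mass_eq: "mass u = 1 + real (card Vt) + real (card Hz)"
    using un fin by (simp add: card_hood[symmetric] hood_eq card_Un_disjoint)
  have "(\<Sum>v\<in>hood u. wave j v) = s + real (card Vt) * (cos \<theta> * s) + real (card Hz) * s"
    unfolding hood_eq using un fin wu Vt_sum Hz_wave by (simp add: sum.union_disjoint)
  moreover have "cos \<theta> * s \<le> 1 * s" using s0 by (intro mult_right_mono) auto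
  ultimately have "cos \<theta> * s * mass u \<le> (\<Sum>v\<in>hood u. wave j v)"
    using mult_left_mono[of "cos \<theta> * s" s "real (card Hz)"] by (simp add: mass_eq algebra_simps)
  then show ?thesis
    using mass_pos[of u] unfolding \<theta>_def[symmetric] by (simp add: avg_def wu pos_le_divide_eq)
qed

text \<open>The walk follows a fixed path of \<open>j + 1\<close> arcs to \<open>x\<close>, returns
  to \<open>x\<close> after \<open>2 * n\<close> further steps, and goes back along the path. The
  point \<open>x\<close> has height 1 because the wave vanishes at height 0.\<close>

lemma root_return_lower:
  "(1 / 22) ^ (2 * (j + 1)) * (cos (pi / (2 * real (K j))) ^ n * sin (pi / (2 * real (K j))))\<^sup>2
    \<le> 22 * real (2 ^ j * (K j + 1)) * pmf (walk T (2 * n + 2 * (j + 1)) ([], 0)) ([], 0)"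
proof -
  define x where "x = (replicate j True, Suc 0)"
  define \<gamma> where "\<gamma> i = (if i \<le> j then (replicate i True, 0) else x)" for i
  have x_block: "x \<in> block j" using K_pos[of j] by (simp add: x_def block_def)
  have path_step: "\<gamma> (Suc i) \<in> hood (\<gamma> i)" if "i < j + 1" for i
  proof -
    have "\<gamma> (Suc i) \<in> V" "\<gamma> i \<in> V" using x_block block_V by (auto simp: \<gamma>_def V_def)
    moreover have "adj (\<gamma> i) (\<gamma> (Suc i))" using that by (auto simp: \<gamma>_def adj_def x_def)
    ultimately show ?thesis by (simp add: hood_def neighbours_def T_simps)
  qed
  have ends: "\<gamma> 0 = ([], 0)" "\<gamma> (j + 1) = x" by (simp_all add: \<gamma>_def)
  have to_x: "(1 / 22) ^ (j + 1) \<le> pmf (walk T (j + 1) ([], 0)) x"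
    using walk_path_ge[of "j + 1" \<gamma>, OF path_step] unfolding ends by simp
  have from_x: "(1 / 22) ^ (j + 1) \<le> pmf (walk T (j + 1) x) ([], 0)"
  proof -
    have "\<gamma> (j + 1 - Suc i) \<in> hood (\<gamma> (j + 1 - i))" if "i < j + 1" for i
      using path_step[of "j + 1 - Suc i"] that hood_sym by (simp add: Suc_diff_le)
    from walk_path_ge[of "j + 1" "\<lambda>i. \<gamma> (j + 1 - i)", OF this] show ?thesis
      using ends by simp
  qed
  have "(cos (pi / (2 * real (K j))) ^ n * wave j x)\<^sup>2 \<le> (real 21 + 1) * real (card (block j)) * pmf (walk T (2 * n) x) x"
  proof (rule return_probability_lower[OF finite_block _ wave_bounds _ wave_subharmonic])
    show "0 \<le> cos (pi / (2 * real (K j)))"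
    proof (rule cos_ge_zero)
      have "pi / (2 * real (K j)) \<le> pi / 2" using K_pos[of j] by (intro divide_left_mono) auto
      moreover have "0 \<le> pi / (2 * real (K j))" by simp
      ultimately show "- (pi / 2) \<le> pi / (2 * real (K j))" "pi / (2 * real (K j)) \<le> pi / 2"
        using pi_gt_zero by linarith+
    qed
  qed (simp add: wave_def)
  moreover have "wave j x = sin (pi / (2 * real (K j)))" using x_block by (simp add: wave_def x_def)
  ultimately have mid: "(cos (pi / (2 * real (K j))) ^ n * sin (pi / (2 * real (K j))))\<^sup>2
      \<le> 22 * real (2 ^ j * (K j + 1)) * pmf (walk T (2 * n) x) x" by (simp add: card_block)
  have "(1 / 22) ^ (j + 1) * pmf (walk T (2 * n) x) x * (1 / 22) ^ (j + 1)
      \<le> pmf (walk T (j + 1) ([], 0)) x * pmf (walk T (2 * n) x) x * pmf (walk T (j + 1) x) ([], 0)"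
    by (intro mult_mono to_x from_x) auto
  also have "\<dots> \<le> pmf (walk T (j + 1 + 2 * n) ([], 0)) x * pmf (walk T (j + 1) x) ([], 0)"
    by (intro mult_right_mono walk_chapman_ge) auto
  also have "\<dots> \<le> pmf (walk T (j + 1 + 2 * n + (j + 1)) ([], 0)) ([], 0)"
    by (rule walk_chapman_ge)
  finally have chain: "(1 / 22) ^ (2 * (j + 1)) * pmf (walk T (2 * n) x) x
      \<le> pmf (walk T (2 * n + 2 * (j + 1)) ([], 0)) ([], 0)"
  proof -
    assume *: "(1 / 22) ^ (j + 1) * pmf (walk T (2 * n) x) x * (1 / 22) ^ (j + 1)
      \<le> pmf (walk T (j + 1 + 2 * n + (j + 1)) ([], 0)) ([], 0)"
    have "j + 1 + 2 * n + (j + 1) = 2 * n + 2 * (j + 1)" by simp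
    moreover have "(1 / 22) ^ (2 * (j + 1)) * pmf (walk T (2 * n) x) x
        = (1 / 22) ^ (j + 1) * pmf (walk T (2 * n) x) x * (1 / 22) ^ (j + 1)"
    proof -
      have "a ^ (2 * m) * c = a ^ m * c * a ^ m" for a c :: real and m :: nat
        unfolding mult_2 power_add by (simp only: mult_ac)
      then show ?thesis .
    qed
    ultimately show ?thesis using * by (simp only:)
  qed
  have "(1 / 22) ^ (2 * (j + 1)) * (cos (pi / (2 * real (K j))) ^ n * sin (pi / (2 * real (K j))))\<^sup>2
      \<le> (1 / 22) ^ (2 * (j + 1)) * (22 * real (2 ^ j * (K j + 1)) * pmf (walk T (2 * n) x) x)"
    by (intro mult_left_mono mid) auto
  also have "\<dots> = 22 * real (2 ^ j * (K j + 1)) * ((1 / 22) ^ (2 * (j + 1)) * pmf (walk T (2 * n) x) x)"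
    by (simp only: mult_ac)
  also have "\<dots> \<le> 22 * real (2 ^ j * (K j + 1)) * pmf (walk T (2 * n + 2 * (j + 1)) ([], 0)) ([], 0)"
    by (intro mult_left_mono chain) auto
  finally show ?thesis .
qed

end

section \<open>Calibration of the fibre lengths\<close>

text \<open>For \<open>k = 0\<close> the bound is infinite, in agreement with
  \<open>a * 0 \<le> u\<close>; otherwise both quotients are real and the denominators can be
  cleared.\<close>

lemma ennreal_quotient_le_iff:
  assumes "0 < u"
  shows "(of_nat a / of_nat u :: ennreal) \<le> 1 / of_nat k \<longleftrightarrow> a * k \<le> u"
proof (cases "k = 0")
  case True
  have "(1 / of_nat k :: ennreal) = top" by (simp add: True)
  then show ?thesis using True by simp
next
  case False
  have "(of_nat a / of_nat u :: ennreal) = ennreal (real a / real u)"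
    using assms by (simp add: ennreal_of_nat_eq_real_of_nat divide_ennreal)
  moreover have "(1 / of_nat k :: ennreal) = ennreal (1 / real k)"
    using False divide_ennreal[of 1 "real k"] by (simp add: ennreal_of_nat_eq_real_of_nat)
  moreover have "real a / real u \<le> 1 / real k \<longleftrightarrow> real (a * k) \<le> real u"
    using assms False by (simp add: field_simps)
  ultimately show ?thesis by (simp only: of_nat_le_iff) simp
qed

text \<open>Induction with the addition theorem. For \<open>n = K j\<close> and
  \<open>x = pi / (2 * n)\<close> it yields \<open>1 / n \<le> sin x\<close>.\<close>

lemma abs_sin_mult_le: "\<bar>sin (real n * x)\<bar> \<le> real n * \<bar>sin x\<bar>"
proof (induction n)
  case (Suc n)
  have "real (Suc n) * x = real n * x + x" by (simp add: algebra_simps)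
  then have "\<bar>sin (real (Suc n) * x)\<bar> = \<bar>sin (real n * x) * cos x + cos (real n * x) * sin x\<bar>"
    by (simp only: sin_add)
  also have "\<dots> \<le> \<bar>sin (real n * x)\<bar> * \<bar>cos x\<bar> + \<bar>cos (real n * x)\<bar> * \<bar>sin x\<bar>"
    using abs_triangle_ineq by (simp add: abs_mult[symmetric])
  also have "\<dots> \<le> \<bar>sin (real n * x)\<bar> * 1 + 1 * \<bar>sin x\<bar>"
    by (intro add_mono mult_mono) auto
  also have "\<dots> \<le> real (Suc n) * \<bar>sin x\<bar>" using Suc by (simp add: algebra_simps)
  finally show ?case .
qed simp

text \<open>For y = x^2 \<le> 1 the chain is exp(-y) \<le> 1/(1 + y) \<le> 1 - y/2 \<le> cos x. It
  makes powers of the eigenvalue of the wave exponential in time.\<close>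

lemma cos_ge_exp:
  fixes x :: real
  assumes "x\<^sup>2 \<le> 1"
  shows "exp (- x\<^sup>2) \<le> cos x"
proof -
  have "cos x = 1 - 2 * (sin (x / 2))\<^sup>2" using cos_double_sin[of "x / 2"] by simp
  moreover have "(sin (x / 2))\<^sup>2 \<le> (x / 2)\<^sup>2"
    using abs_sin_x_le_abs_x[of "x / 2"] by (rule abs_le_square_iff[THEN iffD1])
  ultimately have c: "1 - x\<^sup>2 / 2 \<le> cos x" by (simp add: power2_eq_square)
  have "exp (- x\<^sup>2) \<le> 1 / (1 + x\<^sup>2)"
    using exp_ge_add_one_self[of "x\<^sup>2"] by (simp add: exp_minus field_simps add_pos_nonneg)
  also have "\<dots> \<le> 1 - x\<^sup>2 / 2"
  proof -
    have "0 \<le> x\<^sup>2 * (1 - x\<^sup>2)" using assms by (intro mult_nonneg_nonneg) auto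
    then have "1 \<le> (1 - x\<^sup>2 / 2) * (1 + x\<^sup>2)" by (simp add: algebra_simps)
    moreover have "0 < 1 + x\<^sup>2" by (simp add: add_pos_nonneg)
    ultimately show ?thesis by (simp add: divide_le_eq)
  qed
  finally show ?thesis using c by linarith
qed

text \<open>For t = n^\<alpha> the value of \<open>b\<close> gives t^(2b) = n^(1-\<alpha>), so
  staying for a time of order n in fibres of length t^b costs an exponent of order t; moreover
  \<open>1 / b\<close> is the exponent in F. The value of \<open>\<epsilon>\<close> makes
  \<open>(43 + 3 * b) * \<epsilon> = 1 / 2\<close>, and that of \<open>M\<close> makes
  \<open>K j\<close> at least 6 t^b once \<open>j + 1\<close> is at least \<open>\<epsilon>\<close>
  t; this is the budget of \<open>walk_lower\<close>.\<close>

locale calibrated_tree = layered_tree K p for K p +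
  fixes \<alpha> M \<epsilon> b :: real
  assumes \<alpha>: "0 < \<alpha>" "\<alpha> < 1" and b_eq: "b = (1 - \<alpha>) / (2 * \<alpha>)"
    and \<epsilon>_eq: "\<epsilon> = 1 / (2 * (43 + 3 * b))" and M_eq: "M = 2 + 6 * \<epsilon> powr (- b)"
    and K_eq: "K j = nat \<lceil>M * real (j + 1) powr b\<rceil>"
begin

lemma b_pos: "0 < b" and \<alpha>b: "\<alpha> * b = (1 - \<alpha>) / 2"
  using \<alpha> by (simp_all add: b_eq)

lemma \<epsilon>_pos: "0 < \<epsilon>" and \<epsilon>_le: "\<epsilon> \<le> 1"
  using b_pos by (simp_all add: \<epsilon>_eq)

lemma M_ge: "2 \<le> M"
  by (simp add: M_eq)

lemma K_lower: "M * real (j + 1) powr b \<le> real (K j)"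
  unfolding K_eq by (rule real_nat_ceiling_ge)

lemma K_upper: "real (K j) \<le> M * real (j + 1) powr b + 1"
proof -
  have "0 \<le> M * real (j + 1) powr b" using M_ge by simp
  then show ?thesis unfolding K_eq by linarith
qed

lemma K_ge_2: "2 \<le> real (K j)"
proof -
  have "1 \<le> real (j + 1) powr b" using b_pos by (intro ge_one_powr_ge_zero) auto
  then have "2 * 1 \<le> M * real (j + 1) powr b" using M_ge by (intro mult_mono) auto
  then show ?thesis using K_lower[of j] by simp
qed

text \<open>A deliberately crude bound on polynomial growth, which lets fibre lengths be absorbed
  into exponentials in \<open>j\<close>.\<close>

lemma K_exp: "real (K j + 1) \<le> (M + 2) * exp (b * real j)"
proof -
  have "real (j + 1) powr b \<le> exp (real j) powr b"
    using b_pos exp_ge_add_one_self[of "real j"] by (intro powr_mono2) auto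
  then have "real (j + 1) powr b \<le> exp (b * real j)" by (simp add: exp_powr_real mult.commute)
  then have "M * real (j + 1) powr b \<le> M * exp (b * real j)" using M_ge by (intro mult_left_mono) auto
  moreover have "1 \<le> exp (b * real j)" using b_pos by simp
  ultimately show ?thesis using K_upper[of j] unfolding distrib_right of_nat_add of_nat_1 by linarith
qed

text \<open>As \<open>1 \<le> t\<close>, rounding \<open>a * t\<close> up and adding 1 gives at most
  \<open>(a + 2) * t\<close>. The Folner function uses \<open>a = 3\<close>, the walk
  \<open>a = 1\<close>.\<close>

lemma K_at_scale:
  assumes "1 \<le> t" "0 \<le> a"
  shows "real (K (nat \<lceil>a * t\<rceil>)) + 2 \<le> (M * (a + 2) powr b + 3) * t powr b"
proof -
  have "real (nat \<lceil>a * t\<rceil>) \<le> a * t + 1" using assms by (simp add: of_nat_ceiling)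
  then have "real (nat \<lceil>a * t\<rceil> + 1) \<le> (a + 2) * t" using assms by (simp add: algebra_simps)
  then have "real (nat \<lceil>a * t\<rceil> + 1) powr b \<le> ((a + 2) * t) powr b"
    using b_pos by (intro powr_mono2) auto
  also have "\<dots> = (a + 2) powr b * t powr b" using assms by (simp add: powr_mult)
  finally have "M * real (nat \<lceil>a * t\<rceil> + 1) powr b \<le> M * ((a + 2) powr b * t powr b)"
    using M_ge by (intro mult_left_mono) auto
  moreover have "1 \<le> t powr b" using assms b_pos by (intro ge_one_powr_ge_zero) auto
  ultimately show ?thesis using K_upper[of "nat \<lceil>a * t\<rceil>"] by (simp add: algebra_simps)
qed

section \<open>The Folner function of the tree\<close>

lemma Folner_lower:
  "\<exists>c>0. \<forall>n U. U \<subseteq> V \<and> finite U \<and> U \<noteq> {} \<and> card (edge_boundary T U) * (c * n) \<le> card U \<longrightarrow>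
     exp (real n powr (1 / b)) \<le> 2 * real (card U)"
proof -
  define c where "c = nat \<lceil>M * 5 powr b + 3\<rceil> + 1"
  have c: "M * 5 powr b + 3 < real c" unfolding c_def using M_ge by linarith
  have "exp (real n powr (1 / b)) \<le> 2 * real (card U)"
    if U: "U \<subseteq> V" "finite U" "U \<noteq> {}" "card (edge_boundary T U) * (c * n) \<le> card U" for n U
  proof (cases "n = 0")
    case True
    have "1 \<le> card U" using U by (simp add: Suc_le_eq card_gt_0_iff)
    then show ?thesis using True by simp
  next
    case False
    \<comment> \<open>Fibres over levels of order \<open>t\<close> have length of order
      \<open>t powr b = n\<close>, so \<open>K J + 2 < c * n\<close> for a suitable
      \<open>c\<close>. A set with boundary ratio at most \<open>1 / (c * n)\<close> then
      contradicts \<open>isoperimetry\<close> at \<open>J\<close>, unless it is too large for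
      it.\<close>
    define t where "t = real n powr (1 / b)"
    have t1: "1 \<le> t" unfolding t_def using False b_pos by (intro ge_one_powr_ge_zero) auto
    have tb: "t powr b = real n" using b_pos by (simp add: t_def powr_powr)
    \<comment> \<open>The factor 3 and \<open>2 / 3 \<le> ln 2\<close> make \<open>2 ^ J\<close> at
      least the square of \<open>exp t\<close>.\<close>
    define J where "J = nat \<lceil>3 * t\<rceil>"
    have "real (K J) + 2 \<le> (M * 5 powr b + 3) * real n"
      using K_at_scale[OF t1, of 3] by (simp add: J_def tb)
    also have "\<dots> < real c * real n" using c False by (intro mult_strict_right_mono) auto
    finally have "real (K J + 2) < real (c * n)" by simp
    then have KJ: "K J + 2 < c * n" by (simp only: of_nat_less_iff)
    have "\<not> 4 * (card U)\<^sup>2 \<le> 2 ^ J"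
    proof
      assume "4 * (card U)\<^sup>2 \<le> 2 ^ J"
      then have iso: "card U \<le> (K J + 2) * card (edge_boundary T U)"
        using U by (intro isoperimetry) auto
      moreover have "0 < card U" using U by (simp add: card_gt_0_iff)
      ultimately have "0 < card (edge_boundary T U)" by (metis gr0I mult_0_right not_le)
      then have "(K J + 2) * card (edge_boundary T U) < c * n * card (edge_boundary T U)"
        by (intro mult_strict_right_mono KJ)
      then show False using iso U by (simp add: mult.commute)
    qed
    then have "2 ^ J \<le> 4 * (card U)\<^sup>2" by simp
    then have "real (2 ^ J) \<le> real (4 * (card U)\<^sup>2)" by (rule of_nat_mono)
    then have J2: "2 ^ J \<le> (2 * real (card U))\<^sup>2" by (simp add: power_mult_distrib)
    have "2 * t \<le> ln 2 * (3 * t)" using ln2_ge_two_thirds t1 mult_right_mono[of "2/3" "ln 2" "3 * t"] by simp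
    also have "\<dots> \<le> ln 2 * real J"
      unfolding J_def by (intro mult_left_mono real_nat_ceiling_ge) auto
    finally have "exp (2 * t) \<le> exp (ln 2 * real J)" by simp
    also have "\<dots> = 2 ^ J" by (simp add: exp_of_nat2_mult)
    finally have "(exp t)\<^sup>2 \<le> (2 * real (card U))\<^sup>2"
      using J2 by (simp add: exp_double)
    then show ?thesis unfolding t_def by (rule power2_le_imp_le) simp
  qed
  moreover have "0 < c" by (simp add: c_def)
  ultimately show ?thesis by blast
qed

lemma Folner_upper:
  "\<exists>c\<^sub>1>0. \<exists>c\<^sub>2>0. \<forall>n. \<exists>U. U \<subseteq> V \<and> finite U \<and> U \<noteq> {} \<and> card (edge_boundary T U) * n \<le> card U \<and>
     real (card U) \<le> c\<^sub>1 * exp ((c\<^sub>2 * real n) powr (1 / b))"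
proof -
  define c\<^sub>1 where "c\<^sub>1 = (M + 2) * exp (1 + b)"
  define c\<^sub>2 where "c\<^sub>2 = 3 * (1 + b) powr b"
  have "\<exists>U. U \<subseteq> V \<and> finite U \<and> U \<noteq> {} \<and> card (edge_boundary T U) * n \<le> card U \<and>
     real (card U) \<le> c\<^sub>1 * exp ((c\<^sub>2 * real n) powr (1 / b))" for n :: nat
  proof -
    \<comment> \<open>The witness is a block at a level just above \<open>t\<close>. The 3 cancels
      the constant of \<open>card_boundary_block\<close> by forcing \<open>3 * n \<le> K j\<close>.
      The size of the block is of order at most \<open>exp ((1 + b) * t)\<close>, and
      \<open>c\<^sub>2\<close> moves the factor \<open>1 + b\<close> inside the power.\<close>
    define t where "t = (3 * real n) powr (1 / b)"
    define j where "j = nat \<lceil>t\<rceil>"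
    have t0: "0 \<le> t" by (simp add: t_def)
    have tj: "t \<le> real j" "real j \<le> t + 1" using t0 unfolding j_def by linarith+
    have "t powr b = 3 * real n" using b_pos by (simp add: t_def powr_powr)
    then have "3 * real n \<le> real (j + 1) powr b"
      using tj t0 b_pos powr_mono2[of b t "real (j + 1)"] by simp
    moreover have "1 * real (j + 1) powr b \<le> M * real (j + 1) powr b"
      using M_ge by (intro mult_right_mono) auto
    ultimately have "3 * real n \<le> real (K j)" using K_lower[of j] by linarith
    then have nK: "3 * n \<le> K j" by linarith
    have "card (edge_boundary T (block j)) * n \<le> 3 * 2 ^ j * n"
      using card_boundary_block by (rule mult_le_mono1)
    also have "\<dots> = 2 ^ j * (3 * n)" by simp
    also have "\<dots> \<le> 2 ^ j * (K j + 1)" using nK by (intro mult_le_mono2) simp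
    finally have bd: "card (edge_boundary T (block j)) * n \<le> card (block j)" by (simp add: card_block)
    have two: "(2::real) ^ j \<le> exp (real j)"
    proof -
      have "(2::real) ^ j \<le> exp 1 ^ j" using exp_ge_add_one_self[of 1] by (intro power_mono) auto
      then show ?thesis by (simp add: exp_of_nat_mult[symmetric])
    qed
    have "real (card (block j)) = 2 ^ j * real (K j + 1)"
      unfolding card_block by (simp only: of_nat_mult of_nat_power of_nat_numeral)
    also have "\<dots> \<le> exp (real j) * ((M + 2) * exp (b * real j))"
      using two K_exp by (intro mult_mono) auto
    also have "\<dots> = (M + 2) * exp ((1 + b) * real j)"
      by (simp add: exp_add[symmetric] algebra_simps)
    also have "\<dots> \<le> (M + 2) * exp ((1 + b) * (t + 1))"
      using tj b_pos M_ge by (intro mult_left_mono) auto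
    also have "\<dots> = c\<^sub>1 * exp ((1 + b) * t)"
      by (simp add: c\<^sub>1_def exp_add[symmetric] algebra_simps)
    also have "(1 + b) * t = (c\<^sub>2 * real n) powr (1 / b)"
      using b_pos by (simp add: c\<^sub>2_def t_def powr_mult powr_powr)
    finally have "real (card (block j)) \<le> c\<^sub>1 * exp ((c\<^sub>2 * real n) powr (1 / b))" .
    moreover have "block j \<noteq> {}"
    proof -
      have "0 < card (block j)" by (simp add: card_block)
      then show ?thesis by auto
    qed
    ultimately show ?thesis using block_V finite_block bd by blast
  qed
  moreover have "0 < c\<^sub>1" "0 < c\<^sub>2" using M_ge b_pos by (simp_all add: c\<^sub>1_def c\<^sub>2_def)
  ultimately show ?thesis by blast
qed

section \<open>The return probability at the root\<close>

lemma walk_upper_even: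
  "\<exists>C\<ge>1. \<exists>c>0. \<forall>n. pmf (walk T (2 * n) ([], 0)) ([], 0) \<le> C * exp (- c * real n powr \<alpha>)"
proof -
  define A where "A = M * 3 powr b + 3"
  define Q where "Q = (16 * 23 ^ 3 :: real)"
  \<comment> \<open>The rates of the two terms of the maximum in
    \<open>return_probability_upper\<close>: the first from
    \<open>exp (t / 3) \<le> sqrt (2 ^ J)\<close>, the second from
    \<open>H \<le> A * t powr b\<close>.\<close>
  define c where "c = min (1 / 3) (1 / (Q * A\<^sup>2))"
  have A: "0 < A" using M_ge by (simp add: A_def add_pos_pos)
  have Q: "0 < Q" by (simp add: Q_def)
  have c0: "0 < c" using A Q by (simp add: c_def)
  \<comment> \<open>Here 3872 = 22 * 176. The 22 is the valency bound plus one, and 176 = 4 * 22 * 2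
    comes from the threshold \<open>4 * 22 / v\<close> with
    \<open>exp (t / 3) / 2 \<le> v\<close>.\<close>
  have "pmf (walk T (2 * n) ([], 0)) ([], 0) \<le> 3872 * exp (- c * real n powr \<alpha>)" for n
  proof (cases "n = 0")
    case True
    then show ?thesis by simp
  next
    case False
    define t where "t = real n powr \<alpha>"
    have t1: "1 \<le> t" unfolding t_def using False \<alpha> by (intro ge_one_powr_ge_zero) auto
    define J where "J = nat \<lceil>t\<rceil>"
    \<comment> \<open>\<open>real (card U) \<le> v\<close> amounts to the size condition of
      \<open>isoperimetry\<close> at \<open>J\<close>.\<close>
    define v where "v = sqrt (2 ^ J) / 2"
    define H where "H = real (K J + 2)"
    have HA: "H \<le> A * t powr b" using K_at_scale[OF t1, of 1] by (simp add: H_def J_def A_def)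
    have "pmf (walk T (2 * n) ([], 0)) ([], 0)
      \<le> (real 21 + 1) * max (4 * (real 21 + 1) / v) (exp (- real n / (16 * (real 21 + 2) ^ 3 * H\<^sup>2)))"
    proof (rule return_probability_upper)
      fix U assume U: "U \<subseteq> pverts T" "finite U" "real (card U) \<le> v"
      then have "(2 * real (card U))\<^sup>2 \<le> (sqrt (2 ^ J))\<^sup>2" by (intro power_mono) (auto simp: v_def)
      then have "real (4 * (card U)\<^sup>2) \<le> real (2 ^ J)" by (simp add: power_mult_distrib)
      then have "4 * (card U)\<^sup>2 \<le> 2 ^ J" by (simp only: of_nat_le_iff)
      then have "card U \<le> (K J + 2) * card (edge_boundary T U)"
        using U by (intro isoperimetry) (auto simp: T_simps)
      then have "real (card U) \<le> real ((K J + 2) * card (edge_boundary T U))" by (rule of_nat_mono)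
      then show "real (card U) \<le> H * real (card (edge_boundary T U))" by (simp only: H_def of_nat_mult)
    qed (auto simp: v_def H_def T_simps V_def)
    also have "max (4 * (real 21 + 1) / v) (exp (- real n / (16 * (real 21 + 2) ^ 3 * H\<^sup>2)))
      \<le> 176 * exp (- c * t)"
    proof (rule max.boundedI)
      have "exp (t / 3) \<le> sqrt (2 ^ J)"
      proof (rule real_le_rsqrt)
        have "2 / 3 * t \<le> ln 2 * t" using ln2_ge_two_thirds t1 by (intro mult_right_mono) auto
        also have "\<dots> \<le> ln 2 * real J" unfolding J_def by (intro mult_left_mono real_nat_ceiling_ge) auto
        finally have "exp (2 / 3 * t) \<le> exp (ln 2 * real J)" by simp
        also have "\<dots> = 2 ^ J" by (simp add: exp_of_nat2_mult)
        finally show "(exp (t / 3))\<^sup>2 \<le> 2 ^ J" by (simp add: exp_double[symmetric])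
      qed
      then have "exp (t / 3) / 2 \<le> v" by (simp add: v_def)
      then have "4 * (real 21 + 1) / v \<le> 4 * (real 21 + 1) / (exp (t / 3) / 2)"
        by (intro divide_left_mono) (auto simp: v_def)
      also have "\<dots> = 176 * exp (- (t / 3))" by (simp add: exp_minus field_simps)
      also have "\<dots> \<le> 176 * exp (- c * t)"
      proof -
        have "c * t \<le> 1 / 3 * t" using t1 by (intro mult_right_mono) (auto simp: c_def)
        then show ?thesis by simp
      qed
      finally show "4 * (real 21 + 1) / v \<le> 176 * exp (- c * t)" .
      have H0: "0 < H" by (simp add: H_def)
      have "H\<^sup>2 \<le> (A * t powr b)\<^sup>2" using HA H0 by (intro power_mono) auto
      also have "\<dots> = A\<^sup>2 * (real n powr (1 - \<alpha>))"
      proof -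
        have "(t powr b)\<^sup>2 = real n powr (\<alpha> * b + \<alpha> * b)"
          by (simp only: t_def powr_powr power2_eq_square powr_add)
        also have "\<alpha> * b + \<alpha> * b = 1 - \<alpha>" unfolding \<alpha>b by simp
        finally show ?thesis by (simp add: power_mult_distrib)
      qed
      finally have H2: "H\<^sup>2 \<le> A\<^sup>2 * real n powr (1 - \<alpha>)" .
      have nt: "real n = t * real n powr (1 - \<alpha>)" using False by (simp add: t_def powr_add[symmetric])
      have "c * t * (Q * H\<^sup>2) \<le> 1 / (Q * A\<^sup>2) * t * (Q * (A\<^sup>2 * real n powr (1 - \<alpha>)))"
        using t1 Q A H2 c0 by (intro mult_mono) (auto simp: c_def)
      also have "\<dots> = t * real n powr (1 - \<alpha>)" using Q A by (simp add: field_simps)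
      finally have "c * t * (Q * H\<^sup>2) \<le> real n" using nt by simp
      then have "c * t \<le> real n / (Q * H\<^sup>2)" using Q H0 by (simp add: pos_le_divide_eq)
      then have "exp (- real n / (16 * (real 21 + 2) ^ 3 * H\<^sup>2)) \<le> exp (- c * t)"
        by (simp add: Q_def)
      also have "\<dots> \<le> 176 * exp (- c * t)" by simp
      finally show "exp (- real n / (16 * (real 21 + 2) ^ 3 * H\<^sup>2)) \<le> 176 * exp (- c * t)" .
    qed
    finally show ?thesis by (simp add: t_def)
  qed
  then show ?thesis using c0 by (intro exI[of _ 3872]) auto
qed

text \<open>From an odd time, one more step that stays put, of probability at least 1/22, leads to
  an even time. The rate \<open>c\<close> enters the power as \<open>c powr (1 / \<alpha>)\<close>,
  and the half in \<open>c\<^sub>2\<close> reflects that the even bound is indexed by half the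
  time.\<close>

lemma walk_upper:
  "\<exists>c\<^sub>1>0. \<exists>c\<^sub>2>0. \<forall>n. pmf (walk T n ([], 0)) ([], 0) \<le> c\<^sub>1 * exp (- ((c\<^sub>2 * real n) powr \<alpha>))"
proof -
  obtain C c where C: "1 \<le> C" and c: "0 < c"
    and even: "\<And>n. pmf (walk T (2 * n) ([], 0)) ([], 0) \<le> C * exp (- c * real n powr \<alpha>)"
    using walk_upper_even by blast
  define c\<^sub>2 where "c\<^sub>2 = c powr (1 / \<alpha>) / 2"
  have eq: "(c\<^sub>2 * real n) powr \<alpha> = c * (real n / 2) powr \<alpha>" for n
  proof -
    have "c\<^sub>2 * real n = c powr (1 / \<alpha>) * (real n / 2)" by (simp add: c\<^sub>2_def)
    then have "(c\<^sub>2 * real n) powr \<alpha> = (c powr (1 / \<alpha>)) powr \<alpha> * (real n / 2) powr \<alpha>"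
      by (simp only: powr_mult)
    then show ?thesis using \<alpha> c by (simp add: powr_powr)
  qed
  have "pmf (walk T n ([], 0)) ([], 0) \<le> (22 * C) * exp (- ((c\<^sub>2 * real n) powr \<alpha>))" for n
  proof -
    define k where "k = (n + 1) div 2"
    have kn: "real n / 2 \<le> real k" unfolding k_def by linarith
    have "pmf (walk T n ([], 0)) ([], 0) \<le> 22 * pmf (walk T (2 * k) ([], 0)) ([], 0)"
    proof (cases "even n")
      case True
      then have "2 * k = n" by (auto simp: k_def)
      then show ?thesis by (simp del: walk.simps)
    next
      case False
      then have "2 * k = n + Suc 0" by (auto simp: k_def elim!: oddE)
      then have "pmf (walk T n ([], 0)) ([], 0) * pmf (walk T (Suc 0) ([], 0)) ([], 0)
          \<le> pmf (walk T (2 * k) ([], 0)) ([], 0)"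
        using walk_chapman_ge[of n "([], 0)" "([], 0)" "Suc 0" "([], 0)"] by (simp only:)
      moreover have "1 / 22 \<le> pmf (walk T (Suc 0) ([], 0)) ([], 0)"
        using walk_return_ge[of "Suc 0" "([], 0)"] by (simp del: walk.simps)
      then have "pmf (walk T n ([], 0)) ([], 0) * (1 / 22)
          \<le> pmf (walk T n ([], 0)) ([], 0) * pmf (walk T (Suc 0) ([], 0)) ([], 0)"
        by (intro mult_left_mono) auto
      ultimately show ?thesis by simp
    qed
    also have "\<dots> \<le> 22 * (C * exp (- c * real k powr \<alpha>))" by (intro mult_left_mono even) auto
    also have "\<dots> \<le> 22 * (C * exp (- (c * (real n / 2) powr \<alpha>)))"
    proof -
      have "c * (real n / 2) powr \<alpha> \<le> c * real k powr \<alpha>"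
        using kn c \<alpha> by (intro mult_left_mono powr_mono2) auto
      then show ?thesis using C by simp
    qed
    finally show ?thesis by (simp add: eq)
  qed
  moreover have "0 < 22 * C" "0 < c\<^sub>2" using C c by (simp_all add: c\<^sub>2_def)
  ultimately show ?thesis by blast
qed

text \<open>The \<open>4 * n\<close> steps consist of \<open>j + 1\<close> steps out,
  \<open>j + 1\<close> back and an even number in between. The exponents are
  \<open>42 * (j + 1)\<close> for the paths, \<open>16 * n / k\<^sup>2\<close> for the wave and
  \<open>(1 + 3 * b) * j\<close> for the polynomial factors and the block size; they add up to at
  most \<open>42 + t\<close>.\<close>

lemma walk_lower:
  "\<exists>c\<^sub>1>0. \<forall>n. exp (- (real n powr \<alpha>)) \<le> c\<^sub>1 * pmf (walk T (4 * n) ([], 0)) ([], 0)"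
proof -
  define c\<^sub>1 where "c\<^sub>1 = exp 42 * (22 * (M + 2) ^ 3)"
  have c1: "1 \<le> c\<^sub>1"
  proof -
    have "1 * (22 * 1) \<le> c\<^sub>1" unfolding c\<^sub>1_def using M_ge
      by (intro mult_mono one_le_power) auto
    then show ?thesis by simp
  qed
  have "exp (- (real n powr \<alpha>)) \<le> c\<^sub>1 * pmf (walk T (4 * n) ([], 0)) ([], 0)" for n
  proof (cases "n = 0")
    case True
    then show ?thesis using c1 by simp
  next
    case False
    define t where "t = real n powr \<alpha>"
    \<comment> \<open>Rounding down keeps the costs proportional to \<open>j\<close> below
      \<open>\<epsilon> * t\<close>, while \<open>j + 1\<close>, which enters \<open>K j\<close>, is
      still at least \<open>\<epsilon> * t\<close>.\<close>
    define j where "j = nat \<lfloor>\<epsilon> * t\<rfloor>"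
    define q where "q = pmf (walk T (4 * n) ([], 0)) ([], 0)"
    define k where "k = real (K j)"
    define \<theta> where "\<theta> = pi / (2 * k)"
    have t1: "1 \<le> t" unfolding t_def using False \<alpha> by (intro ge_one_powr_ge_zero) auto
    have tn: "t \<le> real n" unfolding t_def using False \<alpha> powr_mono[of \<alpha> 1 "real n"] by simp
    have \<epsilon>t: "0 \<le> \<epsilon> * t" using \<epsilon>_pos t1 by simp
    have j_le: "real j \<le> \<epsilon> * t" and j_ge: "\<epsilon> * t \<le> real (j + 1)"
      using \<epsilon>t unfolding j_def by linarith+
    have "\<epsilon> * t \<le> 1 * t" using \<epsilon>_le t1 by (intro mult_right_mono) auto
    then have jn: "j \<le> n" using j_le tn by linarith
    then have time: "2 * (2 * n - (j + 1)) + 2 * (j + 1) = 4 * n" using False by simp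
    have k2: "2 \<le> k" using K_ge_2 by (simp add: k_def)
    have \<theta>: "0 \<le> \<theta>" "\<theta>\<^sup>2 \<le> 4 / k\<^sup>2" "\<theta>\<^sup>2 \<le> 1"
    proof -
      show "0 \<le> \<theta>" using k2 by (simp add: \<theta>_def)
      have "\<theta> \<le> 2 / k" unfolding \<theta>_def using k2 pi_less_4 by (simp add: field_simps)
      then have "\<theta>\<^sup>2 \<le> (2 / k)\<^sup>2" using \<open>0 \<le> \<theta>\<close> by (intro power_mono) auto
      then show "\<theta>\<^sup>2 \<le> 4 / k\<^sup>2" by (simp add: power_divide)
      also have "4 / k\<^sup>2 \<le> 1" using k2 power_mono[of 2 k 2] by (simp add: divide_le_eq)
      finally show "\<theta>\<^sup>2 \<le> 1" .
    qed
    \<comment> \<open>From \<open>6 * t powr b \<le> k\<close> one gets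
      \<open>36 * real n powr (1 - \<alpha>) \<le> k\<^sup>2\<close>, and 16/36 is below
      1/2.\<close>
    have kn: "16 * real n / k\<^sup>2 \<le> t / 2"
    proof -
      have "6 * \<epsilon> powr (- b) * (\<epsilon> * t) powr b \<le> M * real (j + 1) powr b"
        using j_ge \<epsilon>t b_pos M_ge by (intro mult_mono powr_mono2) (auto simp: M_eq)
      then have "6 * \<epsilon> powr (- b) * (\<epsilon> * t) powr b \<le> k" using K_lower[of j] by (simp add: k_def)
      moreover have "\<epsilon> powr (- b) * (\<epsilon> * t) powr b = t powr b"
        using \<epsilon>_pos t1 by (simp add: powr_mult powr_minus)
      ultimately have "6 * t powr b \<le> k" by (simp add: mult.assoc)
      then have "(6 * t powr b)\<^sup>2 \<le> k\<^sup>2" by (intro power_mono) auto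
      moreover have "(t powr b)\<^sup>2 = real n powr (1 - \<alpha>)"
      proof -
        have "(t powr b)\<^sup>2 = real n powr (\<alpha> * b + \<alpha> * b)"
          by (simp only: t_def powr_powr power2_eq_square powr_add)
        also have "\<alpha> * b + \<alpha> * b = 1 - \<alpha>" unfolding \<alpha>b by simp
        finally show ?thesis .
      qed
      ultimately have "36 * real n powr (1 - \<alpha>) \<le> k\<^sup>2" by (simp add: power_mult_distrib)
      then have "t / 2 * (36 * real n powr (1 - \<alpha>)) \<le> t / 2 * k\<^sup>2"
        using t1 by (intro mult_left_mono) auto
      moreover have "real n = t * real n powr (1 - \<alpha>)" using False by (simp add: t_def powr_add[symmetric])
      ultimately have "16 * real n \<le> t / 2 * k\<^sup>2" by (simp add: mult_ac)
      then show ?thesis using k2 by (simp add: divide_le_eq)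
    qed
    have low: "(1 / 22) ^ (2 * (j + 1)) * (cos \<theta> ^ (2 * n - (j + 1)) * sin \<theta>)\<^sup>2 \<le> 22 * real (2 ^ j * (K j + 1)) * q"
      using root_return_lower[of j "2 * n - (j + 1)"] unfolding time q_def \<theta>_def k_def .
    \<comment> \<open>The crude 22 \<le> exp 21 replaces the logarithm of 22 and accounts for the
      42.\<close>
    have e1: "exp (- 42 * (real j + 1)) \<le> (1 / 22) ^ (2 * (j + 1))"
    proof -
      have "exp (- 21) \<le> 1 / (22 :: real)"
        using exp_ge_add_one_self[of "21 :: real"] by (simp add: exp_minus field_simps)
      then have "exp (- 21) ^ (2 * (j + 1)) \<le> (1 / 22 :: real) ^ (2 * (j + 1))" by (intro power_mono) auto
      moreover have "exp (- 21 :: real) ^ (2 * (j + 1)) = exp (real (2 * (j + 1)) * - 21)"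
        by (rule exp_of_nat_mult[symmetric])
      moreover have "real (2 * (j + 1)) * - 21 = - 42 * (real j + 1)" by simp
      ultimately show ?thesis by (simp only:)
    qed
    have e2: "exp (- (8 * real n / k\<^sup>2)) \<le> cos \<theta> ^ (2 * n - (j + 1))"
    proof -
      have "real (2 * n - (j + 1)) * \<theta>\<^sup>2 \<le> (2 * real n) * (4 / k\<^sup>2)"
        using \<theta> by (intro mult_mono) auto
      then have "exp (- (8 * real n / k\<^sup>2)) \<le> exp (real (2 * n - (j + 1)) * (- \<theta>\<^sup>2))" by simp
      also have "\<dots> = exp (- \<theta>\<^sup>2) ^ (2 * n - (j + 1))" by (rule exp_of_nat_mult)
      also have "\<dots> \<le> cos \<theta> ^ (2 * n - (j + 1))" by (intro power_mono cos_ge_exp \<theta>) auto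
      finally show ?thesis .
    qed
    have e3: "1 / k \<le> sin \<theta>"
    proof -
      have "\<theta> \<le> pi" using k2 by (simp add: \<theta>_def field_simps)
      then have "\<bar>sin \<theta>\<bar> = sin \<theta>" using \<theta> sin_ge_zero by auto
      moreover have "real (K j) * \<theta> = pi / 2" using k2 by (simp add: \<theta>_def k_def)
      then have "sin (real (K j) * \<theta>) = 1" by (simp only: sin_pi_half)
      ultimately have "1 \<le> k * sin \<theta>" using abs_sin_mult_le[of "K j" \<theta>] by (simp add: k_def)
      then show ?thesis using k2 by (simp add: divide_le_eq mult.commute)
    qed
    have "exp (- 42 * (real j + 1)) * (exp (- (8 * real n / k\<^sup>2)) * (1 / k))\<^sup>2
        \<le> (1 / 22) ^ (2 * (j + 1)) * (cos \<theta> ^ (2 * n - (j + 1)) * sin \<theta>)\<^sup>2"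
    proof (intro mult_mono power_mono e1 e2 e3)
      show "0 \<le> cos \<theta> ^ (2 * n - (j + 1))" using e2 by (rule order_trans[rotated]) simp
    qed (use k2 in auto)
    also note low
    finally have "exp (- 42 * (real j + 1)) * (exp (- (8 * real n / k\<^sup>2)) * (1 / k))\<^sup>2 * k\<^sup>2
        \<le> 22 * real (2 ^ j * (K j + 1)) * q * k\<^sup>2" by (intro mult_right_mono) auto
    moreover have "exp (- 42 * (real j + 1)) * (exp (- (8 * real n / k\<^sup>2)) * (1 / k))\<^sup>2 * k\<^sup>2
        = exp (- 42 * (real j + 1) - 16 * real n / k\<^sup>2)"
      using k2 by (simp add: power_mult_distrib power_divide exp_double[symmetric] exp_add[symmetric])
    moreover have "22 * real (2 ^ j * (K j + 1)) * q * k\<^sup>2 = 22 * (2 ^ j * (k + 1) * k\<^sup>2) * q"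
    proof -
      have "real (2 ^ j * (K j + 1)) = 2 ^ j * (k + 1)" by (simp add: k_def algebra_simps)
      then show ?thesis by (simp only: mult_ac)
    qed
    ultimately have "exp (- 42 * (real j + 1) - 16 * real n / k\<^sup>2) \<le> 22 * (2 ^ j * (k + 1) * k\<^sup>2) * q"
      by (simp only:)
    \<comment> \<open>\<open>2 \<le> exp 1\<close> takes care of the level size. The fibre length
      \<open>k + 1\<close> and the \<open>k\<^sup>2\<close> left from
      \<open>1 / k \<le> sin \<theta>\<close> make three factors for \<open>K_exp\<close>, hence the
      \<open>3 * b\<close>.\<close>
    also have "\<dots> \<le> 22 * (exp (real j) * ((M + 2) * exp (b * real j)) ^ 3) * q"
    proof (intro mult_right_mono mult_left_mono)
      have "(2::real) ^ j \<le> exp 1 ^ j" using exp_ge_add_one_self[of 1] by (intro power_mono) auto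
      then have two: "(2::real) ^ j \<le> exp (real j)" by (simp add: exp_of_nat_mult[symmetric])
      have "(k + 1) * k\<^sup>2 \<le> (k + 1) * (k + 1)\<^sup>2"
        using k2 by (intro mult_left_mono power_mono) auto
      also have "\<dots> = (k + 1) ^ 3" by (simp add: power2_eq_square power3_eq_cube)
      also have "\<dots> \<le> ((M + 2) * exp (b * real j)) ^ 3"
        using K_exp[of j] k2 by (intro power_mono) (auto simp: k_def)
      finally have "2 ^ j * ((k + 1) * k\<^sup>2) \<le> exp (real j) * ((M + 2) * exp (b * real j)) ^ 3"
        using two k2 by (intro mult_mono) auto
      then show "2 ^ j * (k + 1) * k\<^sup>2 \<le> exp (real j) * ((M + 2) * exp (b * real j)) ^ 3"
        by (simp add: mult.assoc)
    qed (auto simp: q_def)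
    also have "\<dots> = 22 * (M + 2) ^ 3 * q * exp ((1 + 3 * b) * real j)"
    proof -
      have "exp ((1 + 3 * b) * real j) = exp (real j) * exp (b * real j) ^ 3"
        unfolding exp_of_nat_mult[symmetric] exp_add[symmetric] by (simp add: algebra_simps)
      then show ?thesis by (simp only: power_mult_distrib mult_ac)
    qed
    finally have "exp (- 42 * (real j + 1) - 16 * real n / k\<^sup>2) * exp (- ((1 + 3 * b) * real j))
        \<le> 22 * (M + 2) ^ 3 * q * exp ((1 + 3 * b) * real j) * exp (- ((1 + 3 * b) * real j))"
      by (intro mult_right_mono) auto
    also have "\<dots> = 22 * (M + 2) ^ 3 * q" by (simp add: mult.assoc exp_add[symmetric])
    finally have fin: "exp (- 42 - 16 * real n / k\<^sup>2 - (43 + 3 * b) * real j) \<le> 22 * (M + 2) ^ 3 * q"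
      by (simp add: exp_add[symmetric] algebra_simps)
    have "(43 + 3 * b) * real j \<le> (43 + 3 * b) * (\<epsilon> * t)" using j_le b_pos by (intro mult_left_mono) auto
    also have "\<dots> = t / 2" using b_pos by (simp add: \<epsilon>_eq field_simps)
    finally have "- 42 - t \<le> - 42 - 16 * real n / k\<^sup>2 - (43 + 3 * b) * real j" using kn by linarith
    then have "exp (- 42 - t) \<le> 22 * (M + 2) ^ 3 * q" using fin by (meson exp_le_cancel_iff order_trans)
    then have "exp 42 * exp (- 42 - t) \<le> exp 42 * (22 * (M + 2) ^ 3 * q)" by (intro mult_left_mono) auto
    then show ?thesis by (simp add: exp_add[symmetric] c\<^sub>1_def t_def q_def mult.assoc)
  qed
  then show ?thesis using c1 by (intro exI[of _ c\<^sub>1]) auto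
qed

section \<open>The two comparisons in the extended nonnegative reals\<close>

lemma Folner_T: "Folner T k = (INF U \<in> {U. U \<subseteq> V \<and> finite U \<and> U \<noteq> {} \<and>
    card (edge_boundary T U) * k \<le> card U}. of_nat (card U))"
proof -
  have "{U. U \<subseteq> pverts T \<and> finite U \<and> U \<noteq> {} \<and>
       (of_nat (card (edge_boundary T U)) / of_nat (card U) :: ennreal) \<le> 1 / of_nat k}
     = {U. U \<subseteq> V \<and> finite U \<and> U \<noteq> {} \<and> card (edge_boundary T U) * k \<le> card U}"
    unfolding T_simps
    by (intro Collect_cong conj_cong refl ennreal_quotient_le_iff) (simp add: card_gt_0_iff)
  then show ?thesis by (simp only: Folner_def)
qed

lemma Folner_approx: "approx_fun (Folner T) (\<lambda>x. ennreal (exp (x powr (1 / b))))"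
  unfolding approx_fun_def
proof
  obtain c\<^sub>1 c\<^sub>2 where c: "0 < c\<^sub>1" "0 < c\<^sub>2" and
    U: "\<And>n. \<exists>U. U \<subseteq> V \<and> finite U \<and> U \<noteq> {} \<and> card (edge_boundary T U) * n \<le> card U \<and>
     real (card U) \<le> c\<^sub>1 * exp ((c\<^sub>2 * real n) powr (1 / b))"
    using Folner_upper by blast
  have "Folner T n \<le> ennreal c\<^sub>1 * ennreal (exp ((c\<^sub>2 * real n) powr (1 / b)))" for n
  proof -
    obtain U where U: "U \<subseteq> V" "finite U" "U \<noteq> {}" "card (edge_boundary T U) * n \<le> card U"
      "real (card U) \<le> c\<^sub>1 * exp ((c\<^sub>2 * real n) powr (1 / b))"
      using U[of n] by blast
    have "Folner T n \<le> of_nat (card U)"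
      unfolding Folner_T using U by (intro INF_lower) auto
    also have "\<dots> = ennreal (real (card U))" by (simp add: ennreal_of_nat_eq_real_of_nat)
    also have "\<dots> \<le> ennreal (c\<^sub>1 * exp ((c\<^sub>2 * real n) powr (1 / b)))" using U by (intro ennreal_leI)
    finally show ?thesis using c by (simp add: ennreal_mult)
  qed
  then show "preceq_fun (Folner T) (\<lambda>x. ennreal (exp (x powr (1 / b))))"
    unfolding preceq_fun_def using c by blast
  obtain c where c: "0 < c" and
    low: "\<And>n U. U \<subseteq> V \<and> finite U \<and> U \<noteq> {} \<and> card (edge_boundary T U) * (c * n) \<le> card U \<Longrightarrow>
     exp (real n powr (1 / b)) \<le> 2 * real (card U)"
    using Folner_lower by blast
  have "ennreal (exp (real n powr (1 / b))) \<le> ennreal 2 * Folner T (c * n)" for n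
  proof -
    have "ennreal (exp (real n powr (1 / b)) / 2) \<le> Folner T (c * n)"
      unfolding Folner_T
    proof (rule INF_greatest)
      fix U assume "U \<in> {U. U \<subseteq> V \<and> finite U \<and> U \<noteq> {} \<and> card (edge_boundary T U) * (c * n) \<le> card U}"
      then have "exp (real n powr (1 / b)) / 2 \<le> real (card U)" using low[of U n] by simp
      then show "ennreal (exp (real n powr (1 / b)) / 2) \<le> of_nat (card U)"
        by (simp add: ennreal_of_nat_eq_real_of_nat ennreal_leI)
    qed
    then have "ennreal 2 * ennreal (exp (real n powr (1 / b)) / 2) \<le> ennreal 2 * Folner T (c * n)"
      by (intro mult_left_mono) auto
    moreover have "ennreal 2 * ennreal (exp (real n powr (1 / b)) / 2) = ennreal (exp (real n powr (1 / b)))"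
      by (subst ennreal_mult[symmetric]) auto
    ultimately show ?thesis by simp
  qed
  then show "succeq_fun (Folner T) (\<lambda>x. ennreal (exp (x powr (1 / b))))"
    unfolding succeq_fun_def using c by (intro exI[of _ "2::real"] conjI exI[of _ c]) auto
qed

lemma transition_prob_approx:
  "approx_fun (\<lambda>n. ennreal (transition_prob T n ([], 0) ([], 0))) (\<lambda>x. ennreal (exp (- (x powr \<alpha>))))"
  unfolding approx_fun_def transition_prob_def
proof
  obtain c\<^sub>1 c\<^sub>2 where c: "0 < c\<^sub>1" "0 < c\<^sub>2"
    and up: "\<And>n. pmf (walk T n ([], 0)) ([], 0) \<le> c\<^sub>1 * exp (- ((c\<^sub>2 * real n) powr \<alpha>))"
    using walk_upper by blast
  have "ennreal (pmf (walk T n ([], 0)) ([], 0)) \<le> ennreal c\<^sub>1 * ennreal (exp (- ((c\<^sub>2 * real n) powr \<alpha>)))" for n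
    using c ennreal_leI[OF up[of n]] by (simp add: ennreal_mult)
  then show "preceq_fun (\<lambda>n. ennreal (pmf (walk T n ([], 0)) ([], 0))) (\<lambda>x. ennreal (exp (- (x powr \<alpha>))))"
    unfolding preceq_fun_def using c by blast
  obtain d where d: "0 < d"
    and low: "\<And>n. exp (- (real n powr \<alpha>)) \<le> d * pmf (walk T (4 * n) ([], 0)) ([], 0)"
    using walk_lower by blast
  have "ennreal (exp (- (real n powr \<alpha>))) \<le> ennreal d * ennreal (pmf (walk T (4 * n) ([], 0)) ([], 0))" for n
    using d ennreal_leI[OF low[of n]] by (simp add: ennreal_mult)
  then show "succeq_fun (\<lambda>n. ennreal (pmf (walk T n ([], 0)) ([], 0))) (\<lambda>x. ennreal (exp (- (x powr \<alpha>))))"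
    unfolding succeq_fun_def using d by (intro exI[of _ d] conjI exI[of _ "4::nat"]) auto
qed

lemma infinite_V: "infinite V"
proof -
  have "range (\<lambda>n. (replicate n True, 0::nat)) \<subseteq> V" by (auto simp: V_def)
  moreover have "inj (\<lambda>n. (replicate n True, 0::nat))" by (auto simp: inj_def dest: arg_cong[where f = length])
  ultimately show ?thesis using finite_subset range_inj_infinite by blast
qed

lemma bounded_geometry_T: "bounded_geometry T"
  unfolding bounded_geometry_def valency_def
  using bidirected_T card_neighbours by (intro conjI exI[of _ 21]) simp_all

end

section \<open>Existence of a calibrated tree and conclusion\<close>

lemma calibrated_tree_exists:
  assumes \<alpha>: "0 < \<alpha>" "\<alpha> < 1"
  shows "\<exists>K p M \<epsilon>. calibrated_tree K p \<alpha> M \<epsilon> ((1 - \<alpha>) / (2 * \<alpha>))"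
proof -
  define b where "b = (1 - \<alpha>) / (2 * \<alpha>)"
  define \<epsilon> where "\<epsilon> = 1 / (2 * (43 + 3 * b))"
  define M where "M = 2 + 6 * \<epsilon> powr (- b)"
  define K where "K j = nat \<lceil>M * real (j + 1) powr b\<rceil>" for j
  have b: "0 < b" using \<alpha> by (simp add: b_def)
  have M: "2 \<le> M" by (simp add: M_def)
  define L where "L j = {xs :: bool list. length xs = j}" for j
  have L: "finite (L j)" "card (L j) = 2 ^ j" for j
    using finite_lists_length_eq[of "UNIV :: bool set" j] card_lists_length_eq[of "UNIV :: bool set" j]
    by (simp_all add: L_def)
  have "\<forall>j. \<exists>q :: nat \<Rightarrow> bool list \<Rightarrow> bool list. (\<forall>m. q m permutes L j) \<and>
    (\<forall>S\<subseteq>L j. 4 * (card S)\<^sup>2 \<le> card (L j) \<longrightarrow> 2 * card S \<le> card (\<Union>m<8. q m ` S))"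
    using expanding_permutations_exist[OF L(1)] by blast
  then obtain q :: "nat \<Rightarrow> nat \<Rightarrow> bool list \<Rightarrow> bool list" where perm: "\<And>j m. q j m permutes L j"
    and expand: "\<And>j S. S \<subseteq> L j \<Longrightarrow> 4 * (card S)\<^sup>2 \<le> card (L j) \<Longrightarrow> 2 * card S \<le> card (\<Union>m<8. q j m ` S)"
    by metis
  \<comment> \<open>The permutations chosen separately on each level are glued into maps on all bit
    strings.\<close>
  define p where "p m xs = q (length xs) m xs" for m xs
  have p_length: "length (p m xs) = length xs" for m xs
    using permutes_in_image[OF perm[of "length xs" m], of xs] by (simp add: p_def L_def)
  have "calibrated_tree K p \<alpha> M \<epsilon> b"
  proof
    show "mono K"
    proof (rule monoI)
      fix i j :: nat assume "i \<le> j"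
      then have "M * real (i + 1) powr b \<le> M * real (j + 1) powr b"
        using M b by (intro mult_left_mono powr_mono2) auto
      then show "K i \<le> K j" unfolding K_def by (intro nat_mono ceiling_mono)
    qed
    show "1 \<le> K j" for j
    proof -
      have "1 \<le> real (j + 1) powr b" using b by (intro ge_one_powr_ge_zero) auto
      then have "2 * 1 \<le> M * real (j + 1) powr b" using M by (intro mult_mono) auto
      then show ?thesis unfolding K_def by linarith
    qed
    show "inj (p m)" for m
    proof (rule injI)
      fix xs ys assume eq: "p m xs = p m ys"
      then have "length xs = length ys" using p_length by metis
      then show "xs = ys"
        using eq permutes_inj[OF perm[of "length xs" m]] by (simp add: p_def inj_eq)
    qed
    show "length (p m xs) = length xs" for m xs by (rule p_length)
    show "2 * card S \<le> card (\<Union>m<8. p m ` S)"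
      if S: "S \<subseteq> {xs. length xs = j}" "4 * (card S)\<^sup>2 \<le> 2 ^ j" for S j
    proof -
      have "p m ` S = q j m ` S" for m
        using S by (intro image_cong) (auto simp: p_def)
      then show ?thesis using expand[of S j] S L(2) by (simp add: L_def)
    qed
  qed (simp_all add: \<alpha> b_def \<epsilon>_def M_def K_def)
  then show ?thesis unfolding b_def by blast
qed

theorem proposition1p2:
  fixes \<alpha> :: real and F \<sigma> :: "real \<Rightarrow> real"
  assumes "0 \<le> \<alpha>" and "\<alpha> < 1"
    and "\<And>x. 0 \<le> x \<Longrightarrow> F x = exp (rpow x (2 * \<alpha> / (1 - \<alpha>)))"
    and "\<And>x. 0 \<le> x \<Longrightarrow> \<sigma> x = exp (- rpow x \<alpha>)"
  shows "\<exists>D\<^sub>F :: nat pair_pre_digraph.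
    bounded_geometry D\<^sub>F \<and> infinite (pverts D\<^sub>F) \<and>
    approx_fun (Folner D\<^sub>F) (\<lambda>x. ennreal (F x)) \<and>
    (\<exists>d\<^sub>0\<in>pverts D\<^sub>F.
      approx_fun (\<lambda>n. ennreal (transition_prob D\<^sub>F n d\<^sub>0 d\<^sub>0)) (\<lambda>x. ennreal (\<sigma> x)))"
proof (cases "\<alpha> = 0")
  case True
  \<comment> \<open>For \<alpha> = 0 both functions are constant, and the edgeless graph on the
    naturals has the required behaviour: the walk never moves, and singletons have empty
    boundary.\<close>
  define D :: "nat pair_pre_digraph" where "D = \<lparr>pverts = UNIV, parcs = {}\<rparr>"
  have nbr: "neighbours D a = {}" for a by (simp add: neighbours_def D_def)
  have "pair_bidirected_digraph D" by unfold_locales (auto simp: D_def symmetric_def sym_def)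
  then have bg: "bounded_geometry D" by (auto simp: bounded_geometry_def nbr valency_def)
  have "walk D n a = return_pmf a" for n a
    by (induction n) (simp_all add: walk_step_def nbr bind_return_pmf pmf_of_set_singleton)
  then have p: "transition_prob D n a a = 1" for n a by (simp add: transition_prob_def)
  have fol: "Folner D k = 1" for k
  proof (rule antisym)
    show "Folner D k \<le> 1"
      unfolding Folner_def by (rule INF_lower2[of "{0}"]) (auto simp: D_def edge_boundary_def)
    show "1 \<le> Folner D k"
      unfolding Folner_def
    proof (rule INF_greatest)
      fix U assume "U \<in> {U. U \<subseteq> pverts D \<and> finite U \<and> U \<noteq> {} \<and>
        (of_nat (card (edge_boundary D U)) / of_nat (card U) :: ennreal) \<le> 1 / of_nat k}"
      then have "1 \<le> card U" by (auto simp: Suc_le_eq card_gt_0_iff)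
      then show "1 \<le> (of_nat (card U) :: ennreal)" using of_nat_mono by fastforce
    qed
  qed
  have const: "approx_fun (\<lambda>_. 1) f" if f: "\<And>x. 0 \<le> x \<Longrightarrow> f x = ennreal r" and r: "0 < r" for f r
  proof -
    have "preceq_fun (\<lambda>_. 1) f" unfolding preceq_fun_def
      using r f by (intro exI[of _ "1 / r"] conjI exI[of _ "1::real"]) (auto simp: ennreal_mult[symmetric])
    moreover have "succeq_fun (\<lambda>_. 1) f" unfolding succeq_fun_def
      using r f by (intro exI[of _ r] conjI exI[of _ "1::nat"]) auto
    ultimately show ?thesis by (simp add: approx_fun_def)
  qed
  have "approx_fun (Folner D) (\<lambda>x. ennreal (F x))"
    unfolding fol[abs_def] using assms(3) True by (intro const[of _ "exp 1"]) (auto simp: rpow_def)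
  moreover have "approx_fun (\<lambda>n. ennreal (transition_prob D n 0 0)) (\<lambda>x. ennreal (\<sigma> x))"
    using const[of "\<lambda>x. ennreal (\<sigma> x)" "exp (- 1)"] assms(4) True by (simp add: p rpow_def)
  moreover have "infinite (pverts D)" "0 \<in> pverts D" by (simp_all add: D_def)
  ultimately show ?thesis using bg by blast
next
  case False
  then have \<alpha>: "0 < \<alpha>" "\<alpha> < 1" using assms by auto
  define b where "b = (1 - \<alpha>) / (2 * \<alpha>)"
  obtain K p M \<epsilon> where "calibrated_tree K p \<alpha> M \<epsilon> b"
    using calibrated_tree_exists[OF \<alpha>] by (auto simp: b_def)
  then interpret calibrated_tree K p \<alpha> M \<epsilon> b .
  define D where "D = relabel (to_nat :: bool list \<times> nat \<Rightarrow> nat) T"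
  have inj: "inj (to_nat :: bool list \<times> nat \<Rightarrow> nat)" by simp
  \<comment> \<open>\<open>1 / b\<close> equals \<open>2 * \<alpha> / (1 - \<alpha>)\<close>, which
    is nonzero, so \<open>rpow\<close> is \<open>powr\<close> here.\<close>
  have F: "ennreal (F x) = ennreal (exp (x powr (1 / b)))" if "0 \<le> x" for x
    using assms(3)[OF that] \<alpha> by (simp add: rpow_def b_def)
  have \<sigma>: "ennreal (\<sigma> x) = ennreal (exp (- (x powr \<alpha>)))" if "0 \<le> x" for x
    using assms(4)[OF that] \<alpha> by (simp add: rpow_def)
  \<comment> \<open>\<open>F\<close> and \<open>\<sigma>\<close> are prescribed at nonnegative
    arguments, the only ones at which the comparisons evaluate them.\<close>
  have cong: "approx_fun a f" if "approx_fun a g" "\<And>x. 0 \<le> x \<Longrightarrow> f x = g x" for a f g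
    using that by (simp add: approx_fun_def preceq_fun_def succeq_fun_def less_imp_le cong: conj_cong)
  have "bounded_geometry D" unfolding D_def by (rule bounded_geometry_relabel[OF inj bounded_geometry_T])
  moreover have "infinite (pverts D)"
    using infinite_V finite_image_iff[OF inj_on_subset[OF inj subset_UNIV]]
    by (auto simp: D_def relabel_simps T_simps)
  moreover have "approx_fun (Folner D) (\<lambda>x. ennreal (F x))"
  proof -
    have "Folner D = Folner T" by (rule ext) (simp add: D_def Folner_relabel[OF inj])
    then show ?thesis using cong[OF Folner_approx F] by simp
  qed
  moreover have "approx_fun (\<lambda>n. ennreal (transition_prob D n (to_nat ([] :: bool list, 0::nat)) (to_nat ([] :: bool list, 0::nat))))
      (\<lambda>x. ennreal (\<sigma> x))"
    unfolding D_def transition_prob_relabel[OF inj card_neighbours(1)]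
    by (rule cong[OF transition_prob_approx \<sigma>])
  moreover have "to_nat ([] :: bool list, 0::nat) \<in> pverts D"
    by (auto simp: D_def relabel_simps T_simps V_def)
  ultimately show ?thesis by blast
qed

end
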